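(* Let $M$ be a $2m$-dimensional almost Hermitian manifold with (positive) definite metric $g$, where $m>2$. Suppose that for each point $p\in M$ there exists a constant $c(p)$ such that at least one of the following holds: (i) $\mathrm{Re}\,K^{\mathbb{C}}(\alpha)\le c(p)$ for every nondegenerate antiholomorphic 2-plane $\alpha$ in $(T_pM)^{\mathbb{C}}$; (ii) $\mathrm{Re}\,K^{\mathbb{C}}(\alpha)\ge c(p)$ for every such $\alpha$; (iii) $\mathrm{Im}\,K^{\mathbb{C}}(\alpha)\le c(p)$ for every such $\alpha$; (iv) $\mathrm{Im}\,K^{\mathbb{C}}(\alpha)\ge c(p)$ for every such $\alpha$. Then $M$ is of pointwise constant antiholomorphic sectional curvature.
   Context: An almost Hermitian manifold is a smooth manifold $M$ with a metric tensor $g$ (here Riemannian) and an almost complex structure $J$ satisfying $J^2=-\mathrm{id}$ and $g(X,Y)=g(JX,JY)$. Let $\nabla$ be the Levi-Civita connection, $R(X,Y)=[\nabla_X,\nabla_Y]-\nabla_{[X,Y]}$ the curvature tensor, and $R(X,Y,Z,U)=g(R(X,Y)Z,U)$. A 2-plane $\alpha$ in $T_pM$ is antiholomorphic if $\alpha$ is perpendicular to $J\alpha$. For a 2-plane $\alpha\subset T_pM$ with orthonormal basis $X,Y$, $K(\alpha)=R(X,Y,Y,X)$. $M$ is of pointwise constant antiholomorphic sectional curvature if for every $p\in M$ there is a constant $k(p)$ such that $K(\alpha)=k(p)$ for every antiholomorphic 2-plane $\alpha\subset T_pM$. Let $(T_pM)^{\mathbb{C}}=T_pM\otimes_{\mathbb{R}}\mathbb{C}$;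 $g$, $J$ and $R$ are extended complex (multi)linearly to $(T_pM)^{\mathbb{C}}$ (so $g$ becomes a complex symmetric bilinear form), the extension of $R$ being denoted $R^{\mathbb{C}}$. A 2-plane $\alpha$ in $(T_pM)^{\mathbb{C}}$ (a two-dimensional complex subspace) is nondegenerate if the restriction of $g$ to it is nondegenerate, and antiholomorphic if $\alpha$ is perpendicular to $J\alpha$ with respect to $g$. For a nondegenerate 2-plane $\alpha$ spanned by $X,Y\in(T_pM)^{\mathbb{C}}$, $$K^{\mathbb{C}}(\alpha)=\frac{R^{\mathbb{C}}(X,Y,Y,X)}{g(X,X)g(Y,Y)-g(X,Y)^2}.$$ *)

theory Defs
  imports "HOL-Analysis.Analysis"
begin

section \<open>Smooth maps between Euclidean spaces\<close>

primrec Ck_on :: "nat \<Rightarrow> 'a::euclidean_space set \<Rightarrow> ('a \<Rightarrow> 'b::real_normed_vector) \<Rightarrow> bool" where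
  "Ck_on 0 S f \<longleftrightarrow> continuous_on S f"
| "Ck_on (Suc k) S f \<longleftrightarrow>
     (\<forall>x\<in>S. f differentiable (at x)) \<and>
     (\<forall>v. Ck_on k S (\<lambda>x. frechet_derivative f (at x) v))"

text \<open>Only used for open \<open>S\<close>.\<close>

definition smooth_on :: "'a::euclidean_space set \<Rightarrow> ('a \<Rightarrow> 'b::real_normed_vector) \<Rightarrow> bool" where
  "smooth_on S f \<longleftrightarrow> (\<forall>k. Ck_on k S f)"


section \<open>Smooth manifolds\<close>

text \<open>The manifold is the whole type \<open>'a\<close>; its dimension is \<open>CARD('n)\<close>. In a chart \<open>(U, \<phi>)\<close> the
  values of \<open>\<phi>\<close> outside \<open>U\<close> are irrelevant.\<close>

type_synonym ('a, 'n) chart = "'a set \<times> ('a \<Rightarrow> real ^ 'n)"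

definition chart_inv :: "('a, 'n::finite) chart \<Rightarrow> real ^ 'n \<Rightarrow> 'a" where
  "chart_inv c = inv_into (fst c) (snd c)"

definition is_chart :: "('a::topological_space, 'n::finite) chart \<Rightarrow> bool" where
  "is_chart c \<longleftrightarrow> open (fst c) \<and> open (snd c ` fst c) \<and>
     homeomorphism (fst c) (snd c ` fst c) (snd c) (chart_inv c)"

definition smooth_atlas ::
  "('a::{t2_space, second_countable_topology}, 'n::finite) chart set \<Rightarrow> bool" where
  "smooth_atlas A \<longleftrightarrow>
     (\<forall>c\<in>A. is_chart c) \<and> (\<Union>c\<in>A. fst c) = UNIV \<and>
     (\<forall>c\<in>A. \<forall>d\<in>A. smooth_on (snd c ` (fst c \<inter> fst d)) (snd d \<circ> chart_inv c))"

text \<open>Every point gets a preferred chart of the atlas. The tangent space at \<open>p\<close> is \<open>real ^ 'n\<close>, where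
  \<open>v\<close> stands for the tangent vector whose components in the preferred chart at \<open>p\<close> are \<open>v\<close>.
  For \<open>p\<close> in the domains of \<open>c\<close> and \<open>d\<close>, the map \<open>coord_change c d p\<close> sends the components
  of a tangent vector at \<open>p\<close> in the chart \<open>c\<close> to those in the chart \<open>d\<close>.\<close>

definition chart_at :: "('a, 'n::finite) chart set \<Rightarrow> 'a \<Rightarrow> ('a, 'n) chart" where
  "chart_at A p = (SOME c. c \<in> A \<and> p \<in> fst c)"

definition coord_change ::
  "('a, 'n::finite) chart \<Rightarrow> ('a, 'n) chart \<Rightarrow> 'a \<Rightarrow> real ^ 'n \<Rightarrow> real ^ 'n" where
  "coord_change c d p = frechet_derivative (snd d \<circ> chart_inv c) (at (snd c p))"

text \<open>A vector field \<open>X\<close> assigns to \<open>p\<close> the vector \<open>X p\<close> of the tangent space at \<open>p\<close>;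
  \<open>vf_in_chart A c X\<close> is its coordinate expression in the chart \<open>c\<close>, a function on the image of \<open>c\<close>.\<close>

definition vf_in_chart ::
  "('a, 'n::finite) chart set \<Rightarrow> ('a, 'n) chart \<Rightarrow> ('a \<Rightarrow> real ^ 'n) \<Rightarrow> real ^ 'n \<Rightarrow> real ^ 'n" where
  "vf_in_chart A c X x =
     (let q = chart_inv c x in coord_change (chart_at A q) c q (X q))"

definition smooth_fun :: "('a, 'n::finite) chart set \<Rightarrow> 'a set \<Rightarrow> ('a \<Rightarrow> real) \<Rightarrow> bool" where
  "smooth_fun A U f \<longleftrightarrow> (\<forall>c\<in>A. smooth_on (snd c ` (U \<inter> fst c)) (f \<circ> chart_inv c))"

definition smooth_vf :: "('a, 'n::finite) chart set \<Rightarrow> 'a set \<Rightarrow> ('a \<Rightarrow> real ^ 'n) \<Rightarrow> bool" where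
  "smooth_vf A U X \<longleftrightarrow> (\<forall>c\<in>A. smooth_on (snd c ` (U \<inter> fst c)) (vf_in_chart A c X))"

text \<open>The derivative of \<open>f\<close> at \<open>p\<close> in the direction of the tangent vector \<open>v\<close>.\<close>

definition dir_deriv ::
  "('a, 'n::finite) chart set \<Rightarrow> 'a \<Rightarrow> real ^ 'n \<Rightarrow> ('a \<Rightarrow> real) \<Rightarrow> real" where
  "dir_deriv A p v f =
     (let c = chart_at A p in frechet_derivative (f \<circ> chart_inv c) (at (snd c p)) v)"

definition lie_bracket ::
  "('a, 'n::finite) chart set \<Rightarrow> ('a \<Rightarrow> real ^ 'n) \<Rightarrow> ('a \<Rightarrow> real ^ 'n) \<Rightarrow> 'a \<Rightarrow> real ^ 'n" where
  "lie_bracket A X Y p =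
     (let c = chart_at A p in
        frechet_derivative (vf_in_chart A c Y) (at (snd c p)) (X p)
      - frechet_derivative (vf_in_chart A c X) (at (snd c p)) (Y p))"


section \<open>Almost Hermitian manifolds\<close>

definition riemannian_metric ::
  "('a::topological_space, 'n::finite) chart set \<Rightarrow> ('a \<Rightarrow> real ^ 'n \<Rightarrow> real ^ 'n \<Rightarrow> real) \<Rightarrow> bool" where
  "riemannian_metric A g \<longleftrightarrow>
     (\<forall>p. bilinear (g p)) \<and>
     (\<forall>p v w. g p v w = g p w v) \<and>
     (\<forall>p v. v \<noteq> 0 \<longrightarrow> g p v v > 0) \<and>
     (\<forall>U X Y. open U \<and> smooth_vf A U X \<and> smooth_vf A U Y \<longrightarrow>
        smooth_fun A U (\<lambda>p. g p (X p) (Y p)))"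

definition almost_complex_structure ::
  "('a::topological_space, 'n::finite) chart set \<Rightarrow> ('a \<Rightarrow> real ^ 'n \<Rightarrow> real ^ 'n) \<Rightarrow> bool" where
  "almost_complex_structure A J \<longleftrightarrow>
     (\<forall>p. linear (J p)) \<and>
     (\<forall>p v. J p (J p v) = - v) \<and>
     (\<forall>U X. open U \<and> smooth_vf A U X \<longrightarrow> smooth_vf A U (\<lambda>p. J p (X p)))"

definition almost_hermitian_manifold ::
  "('a::{t2_space, second_countable_topology}, 'n::finite) chart set \<Rightarrow>
   ('a \<Rightarrow> real ^ 'n \<Rightarrow> real ^ 'n \<Rightarrow> real) \<Rightarrow> ('a \<Rightarrow> real ^ 'n \<Rightarrow> real ^ 'n) \<Rightarrow> bool" where
  "almost_hermitian_manifold A g J \<longleftrightarrow>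
     smooth_atlas A \<and> riemannian_metric A g \<and> almost_complex_structure A J \<and>
     (\<forall>p v w. g p (J p v) (J p w) = g p v w)"


section \<open>The Levi-Civita connection and its curvature\<close>

text \<open>A connection acts on vector fields defined on an arbitrary open set \<open>U\<close>. As fields are total
  functions, all conditions are imposed on \<open>U\<close> only; they imply that the restriction of \<open>N X Y\<close>
  to \<open>U\<close> depends only on the restrictions of \<open>X\<close> and \<open>Y\<close>.\<close>

definition affine_connection ::
  "('a::topological_space, 'n::finite) chart set \<Rightarrow>
   (('a \<Rightarrow> real ^ 'n) \<Rightarrow> ('a \<Rightarrow> real ^ 'n) \<Rightarrow> 'a \<Rightarrow> real ^ 'n) \<Rightarrow> bool" where
  "affine_connection A N \<longleftrightarrow>
     (\<forall>U X Y. open U \<and> smooth_vf A U X \<and> smooth_vf A U Y \<longrightarrow>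
        smooth_vf A U (N X Y) \<and>
        (\<forall>X'. smooth_vf A U X' \<longrightarrow>
           (\<forall>p\<in>U. N (\<lambda>q. X q + X' q) Y p = N X Y p + N X' Y p)) \<and>
        (\<forall>Y'. smooth_vf A U Y' \<longrightarrow>
           (\<forall>p\<in>U. N X (\<lambda>q. Y q + Y' q) p = N X Y p + N X Y' p)) \<and>
        (\<forall>f. smooth_fun A U f \<longrightarrow>
           (\<forall>p\<in>U. N (\<lambda>q. f q *\<^sub>R X q) Y p = f p *\<^sub>R N X Y p \<and>
                  N X (\<lambda>q. f q *\<^sub>R Y q) p = dir_deriv A p (X p) f *\<^sub>R Y p + f p *\<^sub>R N X Y p)))"

definition levi_civita ::
  "('a::topological_space, 'n::finite) chart set \<Rightarrow> ('a \<Rightarrow> real ^ 'n \<Rightarrow> real ^ 'n \<Rightarrow> real) \<Rightarrow>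
   (('a \<Rightarrow> real ^ 'n) \<Rightarrow> ('a \<Rightarrow> real ^ 'n) \<Rightarrow> 'a \<Rightarrow> real ^ 'n) \<Rightarrow> bool" where
  "levi_civita A g N \<longleftrightarrow>
     affine_connection A N \<and>
     (\<forall>U X Y. open U \<and> smooth_vf A U X \<and> smooth_vf A U Y \<longrightarrow>
        (\<forall>p\<in>U. N X Y p - N Y X p = lie_bracket A X Y p)) \<and>
     (\<forall>U X Y Z. open U \<and> smooth_vf A U X \<and> smooth_vf A U Y \<and> smooth_vf A U Z \<longrightarrow>
        (\<forall>p\<in>U. dir_deriv A p (X p) (\<lambda>q. g q (Y q) (Z q)) =
                 g p (N X Y p) (Z p) + g p (Y p) (N X Z p)))"

definition curvature_op ::
  "('a, 'n::finite) chart set \<Rightarrow>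
   (('a \<Rightarrow> real ^ 'n) \<Rightarrow> ('a \<Rightarrow> real ^ 'n) \<Rightarrow> 'a \<Rightarrow> real ^ 'n) \<Rightarrow>
   ('a \<Rightarrow> real ^ 'n) \<Rightarrow> ('a \<Rightarrow> real ^ 'n) \<Rightarrow> ('a \<Rightarrow> real ^ 'n) \<Rightarrow> 'a \<Rightarrow> real ^ 'n" where
  "curvature_op A N X Y Z p =
     N X (N Y Z) p - N Y (N X Z) p - N (lie_bracket A X Y) Z p"

text \<open>The extension of a tangent vector \<open>v\<close> at \<open>p\<close> to the smooth vector field on the domain of the
  preferred chart at \<open>p\<close> that has constant components \<open>v\<close> in this chart.\<close>

definition extend_vec :: "('a, 'n::finite) chart set \<Rightarrow> 'a \<Rightarrow> real ^ 'n \<Rightarrow> 'a \<Rightarrow> real ^ 'n" where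
  "extend_vec A p v q = coord_change (chart_at A p) (chart_at A q) q v"

text \<open>As \<open>curvature_op\<close> is tensorial, its value at \<open>p\<close> can be computed from any
  smooth extension of the vectors to a neighbourhood of \<open>p\<close>.\<close>

definition curvature_tensor ::
  "('a, 'n::finite) chart set \<Rightarrow> ('a \<Rightarrow> real ^ 'n \<Rightarrow> real ^ 'n \<Rightarrow> real) \<Rightarrow>
   (('a \<Rightarrow> real ^ 'n) \<Rightarrow> ('a \<Rightarrow> real ^ 'n) \<Rightarrow> 'a \<Rightarrow> real ^ 'n) \<Rightarrow>
   'a \<Rightarrow> real ^ 'n \<Rightarrow> real ^ 'n \<Rightarrow> real ^ 'n \<Rightarrow> real ^ 'n \<Rightarrow> real" where
  "curvature_tensor A g N p x y z u =
     g p (curvature_op A N (extend_vec A p x) (extend_vec A p y) (extend_vec A p z) p) u"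


section \<open>Antiholomorphic sectional curvature\<close>

text \<open>In this and the next section \<open>g\<close>, \<open>J\<close>, \<open>R\<close> are the values of the tensors at one point.\<close>

definition antiholomorphic_plane ::
  "(real ^ 'n \<Rightarrow> real ^ 'n \<Rightarrow> real) \<Rightarrow> (real ^ 'n \<Rightarrow> real ^ 'n) \<Rightarrow> (real ^ 'n::finite) set \<Rightarrow> bool" where
  "antiholomorphic_plane g J \<alpha> \<longleftrightarrow>
     subspace \<alpha> \<and> dim \<alpha> = 2 \<and> (\<forall>x\<in>\<alpha>. \<forall>y\<in>J ` \<alpha>. g x y = 0)"

definition sectional_curvature ::
  "(real ^ 'n \<Rightarrow> real ^ 'n \<Rightarrow> real) \<Rightarrow>
   (real ^ 'n \<Rightarrow> real ^ 'n \<Rightarrow> real ^ 'n \<Rightarrow> real ^ 'n \<Rightarrow> real) \<Rightarrow> (real ^ 'n::finite) set \<Rightarrow> real" where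
  "sectional_curvature g R \<alpha> =
     (THE k. \<exists>x y. span {x, y} = \<alpha> \<and> g x x = 1 \<and> g y y = 1 \<and> g x y = 0 \<and> k = R x y y x)"

definition pointwise_constant_antiholomorphic_curvature ::
  "('a, 'n::finite) chart set \<Rightarrow> ('a \<Rightarrow> real ^ 'n \<Rightarrow> real ^ 'n \<Rightarrow> real) \<Rightarrow>
   ('a \<Rightarrow> real ^ 'n \<Rightarrow> real ^ 'n) \<Rightarrow>
   (('a \<Rightarrow> real ^ 'n) \<Rightarrow> ('a \<Rightarrow> real ^ 'n) \<Rightarrow> 'a \<Rightarrow> real ^ 'n) \<Rightarrow> bool" where
  "pointwise_constant_antiholomorphic_curvature A g J N \<longleftrightarrow>
     (\<forall>p. \<exists>k. \<forall>\<alpha>. antiholomorphic_plane (g p) (J p) \<alpha> \<longrightarrow>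
        sectional_curvature (g p) (curvature_tensor A g N p) \<alpha> = k)"


section \<open>Complexification\<close>

text \<open>The complexification of the tangent space \<open>real ^ 'n\<close> is \<open>complex ^ 'n\<close>. The tensors are
  extended complex multilinearly from their values on the standard basis.\<close>

definition complexify_form ::
  "(real ^ 'n \<Rightarrow> real ^ 'n \<Rightarrow> real) \<Rightarrow> complex ^ 'n \<Rightarrow> complex ^ 'n::finite \<Rightarrow> complex" where
  "complexify_form g X Y =
     (\<Sum>i\<in>UNIV. \<Sum>j\<in>UNIV. X $ i * Y $ j * of_real (g (axis i 1) (axis j 1)))"

definition complexify_endo ::
  "(real ^ 'n \<Rightarrow> real ^ 'n) \<Rightarrow> complex ^ 'n \<Rightarrow> complex ^ 'n::finite" where
  "complexify_endo J X = (\<chi> k. \<Sum>i\<in>UNIV. X $ i * of_real (J (axis i 1) $ k))"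

definition complexify_tensor4 ::
  "(real ^ 'n \<Rightarrow> real ^ 'n \<Rightarrow> real ^ 'n \<Rightarrow> real ^ 'n \<Rightarrow> real) \<Rightarrow>
   complex ^ 'n \<Rightarrow> complex ^ 'n \<Rightarrow> complex ^ 'n \<Rightarrow> complex ^ 'n::finite \<Rightarrow> complex" where
  "complexify_tensor4 R X Y Z U =
     (\<Sum>i\<in>UNIV. \<Sum>j\<in>UNIV. \<Sum>k\<in>UNIV. \<Sum>l\<in>UNIV. X $ i * Y $ j * Z $ k * U $ l *
        of_real (R (axis i 1) (axis j 1) (axis k 1) (axis l 1)))"

text \<open>The prefix \<open>vec\<close> refers to \<open>complex ^ 'n\<close> as a vector space over the complex numbers.\<close>

definition nondeg_antiholomorphic_cplane ::
  "(real ^ 'n \<Rightarrow> real ^ 'n \<Rightarrow> real) \<Rightarrow> (real ^ 'n \<Rightarrow> real ^ 'n) \<Rightarrow> (complex ^ 'n::finite) set \<Rightarrow> bool" where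
  "nondeg_antiholomorphic_cplane g J \<alpha> \<longleftrightarrow>
     vec.subspace \<alpha> \<and> vec.dim \<alpha> = 2 \<and>
     (\<forall>X\<in>\<alpha>. (\<forall>Y\<in>\<alpha>. complexify_form g X Y = 0) \<longrightarrow> X = 0) \<and>
     (\<forall>X\<in>\<alpha>. \<forall>Y\<in>complexify_endo J ` \<alpha>. complexify_form g X Y = 0)"

definition complex_sectional_curvature ::
  "(real ^ 'n \<Rightarrow> real ^ 'n \<Rightarrow> real) \<Rightarrow>
   (real ^ 'n \<Rightarrow> real ^ 'n \<Rightarrow> real ^ 'n \<Rightarrow> real ^ 'n \<Rightarrow> real) \<Rightarrow> (complex ^ 'n::finite) set \<Rightarrow> complex" where
  "complex_sectional_curvature g R \<alpha> =
     (THE k. \<exists>X Y. vec.span {X, Y} = \<alpha> \<and>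
        k = complexify_tensor4 R X Y Y X /
            (complexify_form g X X * complexify_form g Y Y - (complexify_form g X Y)\<^sup>2))"

end

(* Fix a point, let x, y, z be orthonormal and span an antiholomorphic 3-space, write K(x,y) = R(x,y,y,x),
   and take real a, b with a^2 - b^2 = 1. The complex vectors a x + i b z and y are orthonormal and span
   an antiholomorphic complex plane, of curvature
     a^2 K(x,y) - b^2 K(z,y) + i a b (R(x,y,y,z) + R(z,y,y,x)).
   Since b is arbitrary, a one-sided bound on the real part forces K(x,y) = K(z,y), and one on the
   imaginary part forces R(x,y,y,z) + R(z,y,y,x) = 0, which also gives K(x,y) = K(z,y) after rotating
   x and z by 45 degrees. So K is constant on the planes of a real antiholomorphic 3-space. Moreover
   K(x,y) does not change when y is rotated towards J y, because both values equal K(x,z) for some z.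
   Hence K(x,y) depends only on x, and any two unit vectors x, u have a common unitary neighbour as m > 2.
   Of the symmetries of the curvature tensor only the two skew-symmetries are used, no Bianchi identity. *)

theory Submission
  imports Defs
begin

section \<open>Calculus of smooth maps\<close>

text \<open>Real antiholomorphic planes at a point form a compact set, so a bound on their curvature
  would say nothing. The complexified metric is bilinear, not Hermitian: \<open>i z\<close> has
  square -1, and the unit vectors in the span of \<open>x\<close> and \<open>i z\<close> with real
  coefficients form a hyperbola. Along it the curvature grows quadratically unless its leading
  coefficient vanishes, which is why a bound on one side is already restrictive. The relation
  \<open>a\<^sup>2 - b\<^sup>2 = 1\<close> keeps the pair orthonormal, so the denominator of the
  curvature is 1. All of this is linear algebra at one point once the curvature tensor is known to
  be multilinear and skew in both pairs. That is where the analysis lies: the tensor is computed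
  from chart-wise constant extensions of vectors, which add up correctly only on the chart domain,
  while the connection acts on total functions. Hence locality of the connection must come before
  tensoriality. Skewness in the last pair rests on the symmetry of second derivatives.\<close>

lemma frechet_derivative_cong_open:
  assumes "open S" "x \<in> S" "\<And>y. y \<in> S \<Longrightarrow> f y = g y"
  shows "frechet_derivative f (at x) = frechet_derivative g (at x)"
proof -
  \<comment> \<open>\<open>frechet_derivative\<close> is a choice among all derivatives; with
    equivalent predicates the choices agree even where neither function is differentiable.\<close>
  have "(f has_derivative f') (at x) \<longleftrightarrow> (g has_derivative f') (at x)" for f'
    using has_derivative_transform_within_open[of f f' x UNIV S g]
      has_derivative_transform_within_open[of g f' x UNIV S f] assms by auto
  then show ?thesis unfolding frechet_derivative_def by simp
qed

lemma differentiable_cong_open: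
  assumes "open S" "x \<in> S" "\<And>y. y \<in> S \<Longrightarrow> f y = g y"
  shows "f differentiable (at x) \<longleftrightarrow> g differentiable (at x)"
proof -
  have "(f has_derivative f') (at x) \<longleftrightarrow> (g has_derivative f') (at x)" for f'
    using has_derivative_transform_within_open[of f f' x UNIV S g]
      has_derivative_transform_within_open[of g f' x UNIV S f] assms by auto
  then show ?thesis unfolding differentiable_def by simp
qed

lemma has_derivative_frechet:
  "f differentiable (at x) \<Longrightarrow> (f has_derivative frechet_derivative f (at x)) (at x)"
  using frechet_derivative_works by blast

lemma frechet_derivative_scaleR:
  assumes "f differentiable (at x)" "g differentiable (at x)"
  shows "frechet_derivative (\<lambda>y. f y *\<^sub>R g y) (at x) v =
    f x *\<^sub>R frechet_derivative g (at x) v + frechet_derivative f (at x) v *\<^sub>R g x"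
proof -
  have "((\<lambda>y. f y *\<^sub>R g y) has_derivative
    (\<lambda>v. f x *\<^sub>R frechet_derivative g (at x) v + frechet_derivative f (at x) v *\<^sub>R g x)) (at x)"
    by (rule has_derivative_scaleR; rule has_derivative_frechet; fact)
  from frechet_derivative_at[OF this] show ?thesis by metis
qed

lemma frechet_derivative_add:
  assumes "f differentiable (at x)" "g differentiable (at x)"
  shows "frechet_derivative (\<lambda>y. f y + g y) (at x) v =
    frechet_derivative f (at x) v + frechet_derivative g (at x) v"
proof -
  have "((\<lambda>y. f y + g y) has_derivative
    (\<lambda>v. frechet_derivative f (at x) v + frechet_derivative g (at x) v)) (at x)"
    by (rule has_derivative_add; rule has_derivative_frechet; fact)
  from frechet_derivative_at[OF this] show ?thesis by metis
qed

lemma frechet_derivative_bounded_linear: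
  assumes "f differentiable (at x)" "bounded_linear L"
  shows "frechet_derivative (\<lambda>y. L (f y)) (at x) v = L (frechet_derivative f (at x) v)"
proof -
  have "((\<lambda>y. L (f y)) has_derivative (\<lambda>v. L (frechet_derivative f (at x) v))) (at x)"
    by (rule bounded_linear.has_derivative[OF assms(2)]; rule has_derivative_frechet; fact)
  from frechet_derivative_at[OF this] show ?thesis by metis
qed

section \<open>Closure properties of C^k maps\<close>

lemma Ck_on_cong:
  assumes "open S" "\<And>x. x \<in> S \<Longrightarrow> f x = g x"
  shows "Ck_on k S f \<longleftrightarrow> Ck_on k S g"
  using assms(2)
proof (induction k arbitrary: f g)
  case 0
  then show ?case by (simp cong: continuous_on_cong)
next
  case (Suc k)
  have "(\<forall>x\<in>S. f differentiable (at x)) \<longleftrightarrow> (\<forall>x\<in>S. g differentiable (at x))"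
    using differentiable_cong_open[OF assms(1)] Suc.prems by blast
  moreover have "Ck_on k S (\<lambda>x. frechet_derivative f (at x) v) \<longleftrightarrow>
      Ck_on k S (\<lambda>x. frechet_derivative g (at x) v)" for v
    by (rule Suc.IH) (use frechet_derivative_cong_open[OF assms(1)] Suc.prems in metis)
  ultimately show ?case by simp
qed

lemma Ck_on_subset: "Ck_on k S f \<Longrightarrow> T \<subseteq> S \<Longrightarrow> Ck_on k T f"
proof (induction k arbitrary: f)
  case 0
  then show ?case using continuous_on_subset by auto
next
  case (Suc k)
  then show ?case by (meson Ck_on.simps(2) subsetD)
qed

lemma Ck_on_SucD: "Ck_on (Suc k) S f \<Longrightarrow> Ck_on k S f"
proof (induction k arbitrary: f)
  case 0
  then show ?case
    by (auto intro!: continuous_at_imp_continuous_on differentiable_imp_continuous_within)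
next
  case (Suc k)
  then show ?case by (metis Ck_on.simps(2))
qed

lemma Ck_on_const: "Ck_on k S (\<lambda>x. c)"
  by (induction k arbitrary: c) auto

lemma Ck_on_add:
  assumes "open S"
  shows "Ck_on k S f \<Longrightarrow> Ck_on k S g \<Longrightarrow> Ck_on k S (\<lambda>x. f x + g x)"
proof (induction k arbitrary: f g)
  case 0
  then show ?case by (simp add: continuous_on_add)
next
  case (Suc k)
  have "Ck_on k S (\<lambda>x. frechet_derivative (\<lambda>y. f y + g y) (at x) v)" for v
    using Suc Ck_on_cong[OF assms, of "\<lambda>x. frechet_derivative (\<lambda>y. f y + g y) (at x) v"
      "\<lambda>x. frechet_derivative f (at x) v + frechet_derivative g (at x) v" k]
    by (simp add: frechet_derivative_add)
  then show ?case using Suc by simp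
qed

lemma Ck_on_scaleR:
  assumes "open S"
  shows "Ck_on k S f \<Longrightarrow> Ck_on k S g \<Longrightarrow> Ck_on k S (\<lambda>x. f x *\<^sub>R g x)"
proof (induction k arbitrary: f g)
  case 0
  then show ?case by (simp add: continuous_on_scaleR)
next
  case (Suc k)
  have diff: "\<forall>x\<in>S. f differentiable (at x)" "\<forall>x\<in>S. g differentiable (at x)"
    using Suc.prems by auto
  have "Ck_on k S (\<lambda>x. f x *\<^sub>R frechet_derivative g (at x) v + frechet_derivative f (at x) v *\<^sub>R g x)" for v
    by (intro Ck_on_add[OF assms] Suc.IH) (use Suc.prems Ck_on_SucD in auto)
  then have "Ck_on k S (\<lambda>x. frechet_derivative (\<lambda>y. f y *\<^sub>R g y) (at x) v)" for v
    using Ck_on_cong[OF assms, of "\<lambda>x. frechet_derivative (\<lambda>y. f y *\<^sub>R g y) (at x) v"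
      "\<lambda>x. f x *\<^sub>R frechet_derivative g (at x) v + frechet_derivative f (at x) v *\<^sub>R g x" k] diff
    by (simp add: frechet_derivative_scaleR)
  moreover have "(\<lambda>y. f y *\<^sub>R g y) differentiable (at x)" if "x \<in> S" for x
    using has_derivative_scaleR[OF has_derivative_frechet has_derivative_frechet] diff that
    unfolding differentiable_def by blast
  ultimately show ?case by simp
qed

lemma Ck_on_bounded_linear:
  assumes "open S" "bounded_linear L"
  shows "Ck_on k S f \<Longrightarrow> Ck_on k S (\<lambda>x. L (f x))"
proof (induction k arbitrary: f)
  case 0
  then show ?case by (simp add: bounded_linear.continuous_on[OF assms(2)])
next
  case (Suc k)
  have diff: "\<forall>x\<in>S. f differentiable (at x)" using Suc.prems by auto
  have "Ck_on k S (\<lambda>x. L (frechet_derivative f (at x) v))" for v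
    by (intro Suc.IH) (use Suc.prems in auto)
  then have "Ck_on k S (\<lambda>x. frechet_derivative (\<lambda>y. L (f y)) (at x) v)" for v
    using Ck_on_cong[OF assms(1), of "\<lambda>x. frechet_derivative (\<lambda>y. L (f y)) (at x) v"
      "\<lambda>x. L (frechet_derivative f (at x) v)" k] diff
    by (simp add: frechet_derivative_bounded_linear assms(2))
  moreover have "(\<lambda>y. L (f y)) differentiable (at x)" if "x \<in> S" for x
    using bounded_linear.has_derivative[OF assms(2) has_derivative_frechet] diff that
    unfolding differentiable_def by blast
  ultimately show ?case by simp
qed

lemma Ck_on_sum:
  assumes "open S" "finite I" "\<And>i. i \<in> I \<Longrightarrow> Ck_on k S (f i)"
  shows "Ck_on k S (\<lambda>x. \<Sum>i\<in>I. f i x)"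
  using assms(2,3)
proof (induction I rule: finite_induct)
  case empty
  then show ?case by (simp add: Ck_on_const)
next
  case (insert i I)
  then show ?case by (simp add: Ck_on_add[OF assms(1)])
qed

text \<open>The chain rule applies the derivative of \<open>f\<close> to a direction that varies
  with \<open>x\<close>, whereas \<open>Ck_on\<close> controls derivatives in fixed directions only.
  Expanding the direction in \<open>Basis\<close> separates the two dependences.\<close>

lemma frechet_derivative_comp_Basis:
  fixes f :: "'b::euclidean_space \<Rightarrow> 'c::real_normed_vector" and g :: "'a::euclidean_space \<Rightarrow> 'b"
  assumes "g differentiable (at x)" "f differentiable (at (g x))"
  shows "frechet_derivative (\<lambda>x. f (g x)) (at x) v =
    (\<Sum>b\<in>Basis. (frechet_derivative g (at x) v \<bullet> b) *\<^sub>R frechet_derivative f (at (g x)) b)"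
proof -
  let ?D = "frechet_derivative f (at (g x))" and ?w = "frechet_derivative g (at x) v"
  have "frechet_derivative (\<lambda>x. f (g x)) (at x) v = ?D ?w"
    using frechet_derivative_compose[OF assms] by (simp add: o_def)
  also have "?D ?w = ?D (\<Sum>b\<in>Basis. (?w \<bullet> b) *\<^sub>R b)"
    by (simp add: euclidean_representation)
  also have "\<dots> = (\<Sum>b\<in>Basis. (?w \<bullet> b) *\<^sub>R ?D b)"
    using linear_frechet_derivative[OF assms(2)] by (simp add: linear_sum linear_scale)
  finally show ?thesis .
qed

lemma Ck_on_compose:
  fixes f :: "'b::euclidean_space \<Rightarrow> 'c::real_normed_vector" and g :: "'a::euclidean_space \<Rightarrow> 'b"
  assumes "open S"
  shows "Ck_on k T f \<Longrightarrow> Ck_on k S g \<Longrightarrow> g ` S \<subseteq> T \<Longrightarrow> Ck_on k S (\<lambda>x. f (g x))"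
proof (induction k arbitrary: f)
  case 0
  then show ?case using continuous_on_compose2 by fastforce
next
  case (Suc k)
  have diff: "\<forall>x\<in>S. g differentiable (at x)" "\<forall>x\<in>S. f differentiable (at (g x))"
    using Suc.prems by auto
  have "Ck_on k S (\<lambda>x. \<Sum>b\<in>Basis. (frechet_derivative g (at x) v \<bullet> b) *\<^sub>R frechet_derivative f (at (g x)) b)" for v
  proof (intro Ck_on_sum Ck_on_scaleR assms finite_Basis)
    fix b :: 'b
    show "Ck_on k S (\<lambda>x. frechet_derivative g (at x) v \<bullet> b)"
      by (rule Ck_on_bounded_linear[OF assms bounded_linear_inner_left]) (use Suc.prems in simp)
    show "Ck_on k S (\<lambda>x. frechet_derivative f (at (g x)) b)"
      by (rule Suc.IH) (use Suc.prems Ck_on_SucD[of k S g] in auto)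
  qed
  then have "Ck_on k S (\<lambda>x. frechet_derivative (\<lambda>x. f (g x)) (at x) v)" for v
    using Ck_on_cong[OF assms, of "\<lambda>x. frechet_derivative (\<lambda>x. f (g x)) (at x) v" "\<lambda>x. \<Sum>b\<in>Basis. (frechet_derivative g (at x) v \<bullet> b) *\<^sub>R frechet_derivative f (at (g x)) b"]
      frechet_derivative_comp_Basis[of g _ f] diff by simp
  moreover have "(\<lambda>x. f (g x)) differentiable (at x)" if "x \<in> S" for x
    using diff that differentiable_chain_at[of g x f] by (simp add: o_def)
  ultimately show ?case by simp
qed

lemma smooth_on_cong: "open S \<Longrightarrow> (\<And>x. x \<in> S \<Longrightarrow> f x = g x) \<Longrightarrow> smooth_on S f \<longleftrightarrow> smooth_on S g"
  unfolding smooth_on_def using Ck_on_cong by blast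

lemma smooth_on_subset: "smooth_on S f \<Longrightarrow> T \<subseteq> S \<Longrightarrow> smooth_on T f"
  unfolding smooth_on_def using Ck_on_subset by blast

lemma smooth_on_const: "smooth_on S (\<lambda>x. c)"
  unfolding smooth_on_def using Ck_on_const by blast

lemma smooth_on_add: "open S \<Longrightarrow> smooth_on S f \<Longrightarrow> smooth_on S g \<Longrightarrow> smooth_on S (\<lambda>x. f x + g x)"
  unfolding smooth_on_def using Ck_on_add by blast

lemma smooth_on_scaleR:
  "open S \<Longrightarrow> smooth_on S f \<Longrightarrow> smooth_on S g \<Longrightarrow> smooth_on S (\<lambda>x. f x *\<^sub>R g x)"
  unfolding smooth_on_def using Ck_on_scaleR by blast

lemma smooth_on_compose:
  "open S \<Longrightarrow> smooth_on T f \<Longrightarrow> smooth_on S g \<Longrightarrow> g ` S \<subseteq> T \<Longrightarrow> smooth_on S (\<lambda>x. f (g x))"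
  unfolding smooth_on_def using Ck_on_compose by blast

lemma smooth_on_differentiable: "smooth_on S f \<Longrightarrow> x \<in> S \<Longrightarrow> f differentiable (at x)"
  unfolding smooth_on_def by (metis Ck_on.simps(2))

lemma smooth_on_frechet_derivative:
  "smooth_on S f \<Longrightarrow> smooth_on S (\<lambda>x. frechet_derivative f (at x) v)"
  unfolding smooth_on_def by (metis Ck_on.simps(2))

lemma smooth_on_continuous: "smooth_on S f \<Longrightarrow> continuous_on S f"
  unfolding smooth_on_def by (metis Ck_on.simps(1))

section \<open>Symmetry of second derivatives\<close>

lemma has_real_derivative_along_line:
  fixes f :: "'a::real_normed_vector \<Rightarrow> real"
  assumes "f differentiable (at (b + s *\<^sub>R v))"
  shows "((\<lambda>s. f (b + s *\<^sub>R v)) has_real_derivative frechet_derivative f (at (b + s *\<^sub>R v)) v) (at s)"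
proof -
  let ?D = "frechet_derivative f (at (b + s *\<^sub>R v))"
  have 1: "((\<lambda>s. b + s *\<^sub>R v) has_derivative (\<lambda>t. t *\<^sub>R v)) (at s)"
    by (auto intro!: derivative_eq_intros)
  have "((\<lambda>s. f (b + s *\<^sub>R v)) has_derivative (\<lambda>t. ?D (t *\<^sub>R v))) (at s)"
    using diff_chain_at[OF 1 has_derivative_frechet[OF assms]] by (simp add: o_def)
  moreover have "?D (t *\<^sub>R v) = ?D v * t" for t
    using linear_frechet_derivative[OF assms] by (simp add: linear_scale)
  ultimately show ?thesis unfolding has_field_derivative_def by simp
qed

text \<open>The left side of the equation is symmetric in \<open>v\<close> and \<open>w\<close>, the
  right side is not; this is what makes the mixed derivatives comparable. Two applications of the
  mean value theorem, first along \<open>v\<close> and then along \<open>w\<close>, give the point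
  \<open>y\<close>.\<close>

lemma second_difference_mean_value:
  fixes f :: "'a::euclidean_space \<Rightarrow> real"
  assumes f: "smooth_on (ball a e) f" and h: "h > 0" "h * (norm v + norm w) < e"
  obtains y where "norm (y - a) \<le> h * (norm v + norm w)"
    "f (a + h *\<^sub>R v + h *\<^sub>R w) - f (a + h *\<^sub>R v) - f (a + h *\<^sub>R w) + f a =
      h\<^sup>2 * frechet_derivative (\<lambda>x. frechet_derivative f (at x) v) (at y) w"
proof -
  have near: "norm (s *\<^sub>R v + t *\<^sub>R w) \<le> h * (norm v + norm w)" if "0 \<le> s" "s \<le> h" "0 \<le> t" "t \<le> h" for s t
  proof -
    have "norm (s *\<^sub>R v + t *\<^sub>R w) \<le> s * norm v + t * norm w"
      using that norm_triangle_ineq[of "s *\<^sub>R v" "t *\<^sub>R w"] by simp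
    also have "\<dots> \<le> h * norm v + h * norm w"
      using that by (intro add_mono mult_right_mono) auto
    finally show ?thesis by (simp add: algebra_simps)
  qed
  have inb: "a + s *\<^sub>R v + t *\<^sub>R w \<in> ball a e" if "0 \<le> s" "s \<le> h" "0 \<le> t" "t \<le> h" for s t
  proof -
    have "norm ((a + s *\<^sub>R v + t *\<^sub>R w) - a) < e"
      using near[OF that] h(2) by (simp add: add.assoc)
    then show ?thesis by (metis dist_commute dist_norm mem_ball)
  qed
  let ?Dv = "\<lambda>x. frechet_derivative f (at x) v"
  have d0: "((\<lambda>s. f (a + s *\<^sub>R v)) has_real_derivative ?Dv (a + s *\<^sub>R v)) (at s)" if "0 \<le> s" "s \<le> h" for s
    using inb[of s 0] that h
    by (intro has_real_derivative_along_line smooth_on_differentiable[OF f]) auto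
  have d1: "((\<lambda>s. f (a + s *\<^sub>R v + h *\<^sub>R w)) has_real_derivative ?Dv (a + s *\<^sub>R v + h *\<^sub>R w)) (at s)"
    if "0 \<le> s" "s \<le> h" for s
  proof -
    have "a + s *\<^sub>R v + h *\<^sub>R w \<in> ball a e" by (rule inb) (use that h in auto)
    then have "f differentiable (at ((a + h *\<^sub>R w) + s *\<^sub>R v))"
      using smooth_on_differentiable[OF f] by (simp add: algebra_simps)
    from has_real_derivative_along_line[OF this] show ?thesis by (simp add: algebra_simps)
  qed
  \<comment> \<open>The mean value theorem is applied to the increment in direction
    \<open>w\<close>, as a function of the step in direction \<open>v\<close>.\<close>
  obtain s where s: "0 < s" "s < h"
    "(f (a + h *\<^sub>R v + h *\<^sub>R w) - f (a + h *\<^sub>R v)) - (f (a + 0 *\<^sub>R v + h *\<^sub>R w) - f (a + 0 *\<^sub>R v)) =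
      (h - 0) * (?Dv (a + s *\<^sub>R v + h *\<^sub>R w) - ?Dv (a + s *\<^sub>R v))"
    using MVT2[OF h(1), of "\<lambda>s. f (a + s *\<^sub>R v + h *\<^sub>R w) - f (a + s *\<^sub>R v)"
        "\<lambda>s. ?Dv (a + s *\<^sub>R v + h *\<^sub>R w) - ?Dv (a + s *\<^sub>R v)"] DERIV_diff[OF d1 d0] by blast
  have d2: "((\<lambda>t. ?Dv (a + s *\<^sub>R v + t *\<^sub>R w)) has_real_derivative
      frechet_derivative ?Dv (at (a + s *\<^sub>R v + t *\<^sub>R w)) w) (at t)" if "0 \<le> t" "t \<le> h" for t
    using inb[of s t] that s
    by (intro has_real_derivative_along_line smooth_on_differentiable[OF smooth_on_frechet_derivative[OF f]]) auto
  obtain t where t: "0 < t" "t < h" "?Dv (a + s *\<^sub>R v + h *\<^sub>R w) - ?Dv (a + s *\<^sub>R v + 0 *\<^sub>R w) =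
      (h - 0) * frechet_derivative ?Dv (at (a + s *\<^sub>R v + t *\<^sub>R w)) w"
    using MVT2[OF h(1), of "\<lambda>t. ?Dv (a + s *\<^sub>R v + t *\<^sub>R w)", OF d2] by metis
  show ?thesis
  proof (rule that[of "a + s *\<^sub>R v + t *\<^sub>R w"])
    show "norm (a + s *\<^sub>R v + t *\<^sub>R w - a) \<le> h * (norm v + norm w)"
      using near[of s t] s t by (simp add: add.assoc)
    show "f (a + h *\<^sub>R v + h *\<^sub>R w) - f (a + h *\<^sub>R v) - f (a + h *\<^sub>R w) + f a =
        h\<^sup>2 * frechet_derivative ?Dv (at (a + s *\<^sub>R v + t *\<^sub>R w)) w"
      using s(3) unfolding power2_eq_square scaleR_zero_left add_0_right t(3)[unfolded scaleR_zero_left add_0_right]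
      by (simp add: algebra_simps)
  qed
qed

text \<open>One and the same second difference equals \<open>h\<^sup>2\<close> times either mixed
  derivative at points close to \<open>a\<close>; continuity of both at \<open>a\<close> then leaves
  no room for a gap.\<close>

lemma second_derivative_commute:
  fixes f :: "'a::euclidean_space \<Rightarrow> real"
  assumes f: "smooth_on S f" and S: "open S" "a \<in> S"
  shows "frechet_derivative (\<lambda>x. frechet_derivative f (at x) v) (at a) w =
    frechet_derivative (\<lambda>x. frechet_derivative f (at x) w) (at a) v"
proof (rule ccontr)
  let ?A = "\<lambda>x. frechet_derivative (\<lambda>x. frechet_derivative f (at x) v) (at x) w"
  let ?B = "\<lambda>x. frechet_derivative (\<lambda>x. frechet_derivative f (at x) w) (at x) v"
  assume ne: "?A a \<noteq> ?B a"
  obtain e where e: "e > 0" "ball a e \<subseteq> S" using S openE by blast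
  have fe: "smooth_on (ball a e) f" using smooth_on_subset[OF f e(2)] .
  \<comment> \<open>Half the gap: a common value within \<open>d\<close> of both numbers would bring
    them closer than \<open>2 * d\<close>.\<close>
  define d where "d = \<bar>?A a - ?B a\<bar> / 2"
  have d: "d > 0" using ne by (simp add: d_def)
  have "continuous_on S ?A" "continuous_on S ?B"
    using f by (auto intro!: smooth_on_continuous smooth_on_frechet_derivative)
  then have "isCont ?A a" "isCont ?B a"
    using S continuous_on_eq_continuous_at by blast+
  then obtain r1 r2 where r: "r1 > 0" "\<And>y. dist y a < r1 \<Longrightarrow> dist (?A y) (?A a) < d"
      "r2 > 0" "\<And>y. dist y a < r2 \<Longrightarrow> dist (?B y) (?B a) < d"
    using d unfolding continuous_at_eps_delta by blast
  \<comment> \<open>The summand 1 keeps the denominator positive when \<open>v\<close> and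
    \<open>w\<close> vanish and makes the inequalities in \<open>h1\<close> strict.\<close>
  define h where "h = min e (min r1 r2) / (norm v + norm w + 1)"
  have pos: "norm v + norm w + 1 > 0" by (smt (verit) norm_ge_zero)
  have h0: "h > 0" unfolding h_def using e r pos by simp
  have "h * (norm v + norm w) < h * (norm v + norm w + 1)" using h0 by simp
  also have "\<dots> = min e (min r1 r2)" unfolding h_def using pos by simp
  finally have h1: "h * (norm v + norm w) < e" "h * (norm v + norm w) < r1" "h * (norm v + norm w) < r2"
    by auto
  obtain y where y: "norm (y - a) \<le> h * (norm v + norm w)"
    "f (a + h *\<^sub>R v + h *\<^sub>R w) - f (a + h *\<^sub>R v) - f (a + h *\<^sub>R w) + f a = h\<^sup>2 * ?A y"
    using second_difference_mean_value[OF fe h0 h1(1)] by blast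
  have h1': "h * (norm w + norm v) < e" using h1 by (simp add: add.commute)
  obtain z where z: "norm (z - a) \<le> h * (norm w + norm v)"
    "f (a + h *\<^sub>R w + h *\<^sub>R v) - f (a + h *\<^sub>R w) - f (a + h *\<^sub>R v) + f a = h\<^sup>2 * ?B z"
    using second_difference_mean_value[OF fe h0 h1'] by blast
  have "f (a + h *\<^sub>R w + h *\<^sub>R v) = f (a + h *\<^sub>R v + h *\<^sub>R w)" by (simp add: algebra_simps)
  then have "h\<^sup>2 * ?A y = h\<^sup>2 * ?B z" using y(2) z(2) by linarith
  then have "?A y = ?B z" using h0 by simp
  moreover have "dist (?A y) (?A a) < d" using r(2) y(1) h1 by (auto simp: dist_norm)
  moreover have "dist (?B z) (?B a) < d" using r(4) z(1) h1 by (auto simp: dist_norm add.commute)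
  ultimately show False unfolding d_def dist_real_def by (simp add: abs_if split: if_splits)
qed


section \<open>Coordinate changes and coordinate vector fields\<close>

context
  fixes A :: "('a::{t2_space, second_countable_topology}, 'n::finite) chart set"
  assumes atlas: "smooth_atlas A"
begin

lemma chart_at_mem: "chart_at A p \<in> A" and point_in_chart_at: "p \<in> fst (chart_at A p)"
proof -
  have "\<exists>c. c \<in> A \<and> p \<in> fst c" using atlas unfolding smooth_atlas_def by blast
  from someI_ex[OF this] show "chart_at A p \<in> A" "p \<in> fst (chart_at A p)"
    unfolding chart_at_def by auto
qed

lemma chart_open: "c \<in> A \<Longrightarrow> open (fst c)"
  using atlas unfolding smooth_atlas_def is_chart_def by blast

lemma chart_inv_left [simp]: "c \<in> A \<Longrightarrow> q \<in> fst c \<Longrightarrow> chart_inv c (snd c q) = q"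
  using atlas unfolding smooth_atlas_def is_chart_def homeomorphism_def by blast

lemma chart_image_open:
  assumes "c \<in> A" "open U"
  shows "open (snd c ` (U \<inter> fst c))"
proof -
  have "homeomorphism (fst c) (snd c ` fst c) (snd c) (chart_inv c)" "open (snd c ` fst c)"
    using atlas assms unfolding smooth_atlas_def is_chart_def by blast+
  moreover have "openin (top_of_set (fst c)) (U \<inter> fst c)"
    using assms(2) by (metis Int_commute openin_open_Int)
  ultimately show ?thesis
    using homeomorphism_imp_open_map openin_open_trans by blast
qed

lemma smooth_transition:
  assumes "c \<in> A" "d \<in> A"
  shows "smooth_on (snd c ` (fst c \<inter> fst d)) (snd d \<circ> chart_inv c)"
  using atlas assms unfolding smooth_atlas_def by blast

lemma transition_differentiable:
  assumes "c \<in> A" "d \<in> A" "q \<in> fst c" "q \<in> fst d"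
  shows "(snd d \<circ> chart_inv c) differentiable (at (snd c q))"
  by (rule smooth_on_differentiable[OF smooth_transition]) (use assms in auto)

lemma linear_coord_change:
  assumes "c \<in> A" "d \<in> A" "q \<in> fst c" "q \<in> fst d"
  shows "linear (coord_change c d q)"
  unfolding coord_change_def by (rule linear_frechet_derivative[OF transition_differentiable[OF assms]])

lemma coord_change_self:
  assumes "c \<in> A" "q \<in> fst c"
  shows "coord_change c c q v = v"
proof -
  have "open (snd c ` (fst c \<inter> fst c))" using chart_image_open chart_open assms by blast
  then have "frechet_derivative (snd c \<circ> chart_inv c) (at (snd c q)) = frechet_derivative (\<lambda>x. x) (at (snd c q))"
    by (rule frechet_derivative_cong_open) (use assms in auto)
  then show ?thesis unfolding coord_change_def by simp
qed

text \<open>Cocycle rule: near the point, the transition from \<open>c\<close> to \<open>e\<close>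
  factors through \<open>d\<close>, and the chain rule applies.\<close>

lemma coord_change_compose:
  assumes "c \<in> A" "d \<in> A" "e \<in> A" "q \<in> fst c" "q \<in> fst d" "q \<in> fst e"
  shows "coord_change d e q (coord_change c d q v) = coord_change c e q v"
proof -
  have op: "open (snd c ` (fst d \<inter> fst c))" using chart_image_open chart_open assms by blast
  have q: "chart_inv c (snd c q) = q" using chart_inv_left assms by blast
  have "frechet_derivative (snd e \<circ> chart_inv c) (at (snd c q)) =
      frechet_derivative ((snd e \<circ> chart_inv d) \<circ> (snd d \<circ> chart_inv c)) (at (snd c q))"
    by (rule frechet_derivative_cong_open[OF op]) (use assms in auto)
  also have "\<dots> = frechet_derivative (snd e \<circ> chart_inv d) (at ((snd d \<circ> chart_inv c) (snd c q))) \<circ>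
      frechet_derivative (snd d \<circ> chart_inv c) (at (snd c q))"
    by (rule frechet_derivative_compose) (use assms q transition_differentiable in auto)
  finally show ?thesis unfolding coord_change_def by (simp add: q)
qed

text \<open>\<open>dir_deriv\<close> refers to the preferred chart of \<open>q\<close>, which may
  jump as \<open>q\<close> moves. This moves the computation into one fixed chart \<open>d\<close>,
  where the derivative can be differentiated again.\<close>

lemma dir_deriv_chart:
  assumes "d \<in> A" "q \<in> fst d" "(f \<circ> chart_inv d) differentiable (at (snd d q))"
  shows "dir_deriv A q (coord_change d (chart_at A q) q v) f =
    frechet_derivative (f \<circ> chart_inv d) (at (snd d q)) v"
proof -
  define c where "c = chart_at A q"
  have c: "c \<in> A" "q \<in> fst c" unfolding c_def using chart_at_mem point_in_chart_at by auto
  have op: "open (snd c ` (fst d \<inter> fst c))" using chart_image_open chart_open assms c by blast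
  have q: "chart_inv c (snd c q) = q" using chart_inv_left c by blast
  have "frechet_derivative (f \<circ> chart_inv c) (at (snd c q)) =
      frechet_derivative ((f \<circ> chart_inv d) \<circ> (snd d \<circ> chart_inv c)) (at (snd c q))"
    by (rule frechet_derivative_cong_open[OF op]) (use assms c in auto)
  also have "\<dots> = frechet_derivative (f \<circ> chart_inv d) (at ((snd d \<circ> chart_inv c) (snd c q))) \<circ>
      frechet_derivative (snd d \<circ> chart_inv c) (at (snd c q))"
    by (rule frechet_derivative_compose) (use assms c q transition_differentiable in auto)
  finally have "frechet_derivative (f \<circ> chart_inv c) (at (snd c q)) w =
      frechet_derivative (f \<circ> chart_inv d) (at (snd d q)) (coord_change c d q w)" for w
    unfolding coord_change_def by (simp add: q)
  moreover have "coord_change c d q (coord_change d c q v) = v"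
    using coord_change_compose coord_change_self assms c by simp
  ultimately show ?thesis unfolding dir_deriv_def Let_def c_def[symmetric] by simp
qed

section \<open>Smooth functions and vector fields\<close>

lemma smooth_fun_cong:
  assumes "open U" "\<And>q. q \<in> U \<Longrightarrow> f q = h q"
  shows "smooth_fun A U f \<longleftrightarrow> smooth_fun A U h"
proof -
  have "smooth_on (snd c ` (U \<inter> fst c)) (f \<circ> chart_inv c) \<longleftrightarrow>
      smooth_on (snd c ` (U \<inter> fst c)) (h \<circ> chart_inv c)" if "c \<in> A" for c
    by (rule smooth_on_cong[OF chart_image_open]) (use that assms in auto)
  then show ?thesis unfolding smooth_fun_def by blast
qed

lemma smooth_fun_const: "smooth_fun A U (\<lambda>q. r)"
  unfolding smooth_fun_def by (simp add: o_def smooth_on_const)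

lemma smooth_fun_differentiable:
  assumes "smooth_fun A U f" "d \<in> A" "q \<in> U" "q \<in> fst d"
  shows "(f \<circ> chart_inv d) differentiable (at (snd d q))"
  using assms unfolding smooth_fun_def by (auto intro: smooth_on_differentiable)

lemma vf_in_chart_at:
  "c \<in> A \<Longrightarrow> q \<in> fst c \<Longrightarrow> vf_in_chart A c X (snd c q) = coord_change (chart_at A q) c q (X q)"
  unfolding vf_in_chart_def by (simp add: chart_inv_left)

lemma smooth_vf_cong:
  assumes "open U" "\<And>q. q \<in> U \<Longrightarrow> X q = Y q"
  shows "smooth_vf A U X \<longleftrightarrow> smooth_vf A U Y"
proof -
  have "smooth_on (snd c ` (U \<inter> fst c)) (vf_in_chart A c X) \<longleftrightarrow>
      smooth_on (snd c ` (U \<inter> fst c)) (vf_in_chart A c Y)" if "c \<in> A" for c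
    by (rule smooth_on_cong[OF chart_image_open]) (use that assms in \<open>auto simp: vf_in_chart_at\<close>)
  then show ?thesis unfolding smooth_vf_def by blast
qed

lemma smooth_vf_axpy:
  assumes "open U" "smooth_vf A U X" "smooth_vf A U Y"
  shows "smooth_vf A U (\<lambda>q. a *\<^sub>R X q + Y q)"
  unfolding smooth_vf_def
proof
  fix c assume c: "c \<in> A"
  let ?S = "snd c ` (U \<inter> fst c)"
  have op: "open ?S" using chart_image_open c assms by blast
  have "vf_in_chart A c (\<lambda>q. a *\<^sub>R X q + Y q) x = a *\<^sub>R vf_in_chart A c X x + vf_in_chart A c Y x"
    if "x \<in> ?S" for x
    using that c linear_coord_change[OF chart_at_mem c point_in_chart_at]
    by (auto simp: vf_in_chart_at linear_add linear_scale)
  moreover have "smooth_on ?S (\<lambda>x. a *\<^sub>R vf_in_chart A c X x + vf_in_chart A c Y x)"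
    by (intro smooth_on_add smooth_on_scaleR smooth_on_const op)
      (use assms c in \<open>auto simp: smooth_vf_def\<close>)
  ultimately show "smooth_on ?S (vf_in_chart A c (\<lambda>q. a *\<^sub>R X q + Y q))"
    using smooth_on_cong[OF op, of "vf_in_chart A c (\<lambda>q. a *\<^sub>R X q + Y q)"
      "\<lambda>x. a *\<^sub>R vf_in_chart A c X x + vf_in_chart A c Y x"] by simp
qed

lemma smooth_vf_zero: "smooth_vf A U (\<lambda>q. 0)" if "open U"
  unfolding smooth_vf_def
proof
  fix c assume c: "c \<in> A"
  have "smooth_on (snd c ` (U \<inter> fst c)) (vf_in_chart A c (\<lambda>q. 0)) \<longleftrightarrow>
      smooth_on (snd c ` (U \<inter> fst c)) (\<lambda>x. 0 :: real ^ 'n)"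
    by (rule smooth_on_cong[OF chart_image_open[OF c that]])
      (use c linear_coord_change[OF chart_at_mem c point_in_chart_at] in
        \<open>auto simp: vf_in_chart_at linear_0\<close>)
  then show "smooth_on (snd c ` (U \<inter> fst c)) (vf_in_chart A c (\<lambda>q. 0))"
    by (simp add: smooth_on_const)
qed

section \<open>Coordinate vector fields\<close>

lemma vf_in_chart_extend_vec:
  assumes "c \<in> A" "q \<in> fst c" "q \<in> fst (chart_at A p)"
  shows "vf_in_chart A c (extend_vec A p v) (snd c q) = coord_change (chart_at A p) c q v"
  unfolding vf_in_chart_at[OF assms(1,2)] extend_vec_def
  by (rule coord_change_compose) (use assms chart_at_mem point_in_chart_at in auto)

text \<open>In a chart \<open>c\<close> the components are a derivative of the transition from the
  chart at \<open>p\<close>, in the fixed direction \<open>v\<close>, composed with the inverse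
  transition.\<close>

lemma smooth_vf_extend_vec: "smooth_vf A (fst (chart_at A p)) (extend_vec A p v)"
  unfolding smooth_vf_def
proof
  fix c assume c: "c \<in> A"
  define d where "d = chart_at A p"
  have d: "d \<in> A" unfolding d_def by (rule chart_at_mem)
  let ?S = "snd c ` (fst d \<inter> fst c)"
  have op: "open ?S" using chart_image_open c d chart_open by blast
  let ?D = "\<lambda>y. frechet_derivative (snd c \<circ> chart_inv d) (at y) v"
  have "smooth_on (snd d ` (fst d \<inter> fst c)) ?D"
    by (rule smooth_on_frechet_derivative[OF smooth_transition[OF d c]])
  moreover have "smooth_on ?S (snd d \<circ> chart_inv c)"
    using smooth_transition[OF c d] by (simp add: Int_commute)
  moreover have "(snd d \<circ> chart_inv c) ` ?S \<subseteq> snd d ` (fst d \<inter> fst c)"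
    using c by auto
  ultimately have "smooth_on ?S (\<lambda>x. ?D ((snd d \<circ> chart_inv c) x))"
    by (rule smooth_on_compose[OF op])
  moreover have "vf_in_chart A c (extend_vec A p v) x = ?D ((snd d \<circ> chart_inv c) x)" if "x \<in> ?S" for x
    using that c vf_in_chart_extend_vec[OF c, of _ p v]
    unfolding d_def[symmetric] by (auto simp: coord_change_def)
  ultimately have "smooth_on ?S (vf_in_chart A c (extend_vec A p v))"
    using smooth_on_cong[OF op, of "vf_in_chart A c (extend_vec A p v)"
      "\<lambda>x. ?D ((snd d \<circ> chart_inv c) x)"] by simp
  then show "smooth_on (snd c ` (fst (chart_at A p) \<inter> fst c)) (vf_in_chart A c (extend_vec A p v))"
    unfolding d_def .
qed

lemma extend_vec_axpy:
  assumes "q \<in> fst (chart_at A p)"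
  shows "extend_vec A p (a *\<^sub>R v + w) q = a *\<^sub>R extend_vec A p v q + extend_vec A p w q"
  unfolding extend_vec_def using linear_coord_change[OF chart_at_mem chart_at_mem assms point_in_chart_at]
  by (simp add: linear_add linear_scale)

lemma extend_vec_self: "extend_vec A p v p = v"
  unfolding extend_vec_def by (rule coord_change_self[OF chart_at_mem point_in_chart_at])

text \<open>Both fields have constant components in the preferred chart at \<open>p\<close>, so both
  derivatives in the bracket vanish.\<close>

lemma lie_bracket_extend_vec: "lie_bracket A (extend_vec A p x) (extend_vec A p y) p = 0"
proof -
  define d where "d = chart_at A p"
  have d: "d \<in> A" "p \<in> fst d" unfolding d_def by (auto intro: chart_at_mem point_in_chart_at)
  have op: "open (snd d ` (fst d \<inter> fst d))" using chart_image_open d chart_open by blast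
  have "frechet_derivative (vf_in_chart A d (extend_vec A p v)) (at (snd d p)) =
      frechet_derivative (\<lambda>z. v) (at (snd d p))" for v
  proof (rule frechet_derivative_cong_open[OF op])
    fix z assume "z \<in> snd d ` (fst d \<inter> fst d)"
    then obtain q where q: "z = snd d q" "q \<in> fst d" by blast
    show "vf_in_chart A d (extend_vec A p v) z = v"
      unfolding q(1) using vf_in_chart_extend_vec[OF d(1) q(2), of p v]
        coord_change_self[OF d(1) q(2)] q(2) by (simp add: d_def)
  qed (use d in auto)
  then show ?thesis unfolding lie_bracket_def Let_def d_def[symmetric] by simp
qed

end


section \<open>The curvature tensor\<close>

lemma linearI_axpy:
  fixes f :: "'b::real_vector \<Rightarrow> 'c::real_vector"
  assumes "\<And>a x y. f (a *\<^sub>R x + y) = a *\<^sub>R f x + f y"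
  shows "linear f"
proof (rule linearI)
  show "f (x + y) = f x + f y" for x y using assms[of 1 x y] by simp
  have "f 0 = 0" using assms[of 1 0 0] by simp
  then show "f (a *\<^sub>R x) = a *\<^sub>R f x" for a x using assms[of a x 0] by simp
qed

context
  fixes A :: "('a::{t2_space, second_countable_topology}, 'n::finite) chart set"
    and N :: "('a \<Rightarrow> real ^ 'n) \<Rightarrow> ('a \<Rightarrow> real ^ 'n) \<Rightarrow> 'a \<Rightarrow> real ^ 'n"
  assumes atlas: "smooth_atlas A" and conn: "affine_connection A N"
begin

lemma connection_smooth:
  "open U \<Longrightarrow> smooth_vf A U X \<Longrightarrow> smooth_vf A U Y \<Longrightarrow> smooth_vf A U (N X Y)"
  using conn unfolding affine_connection_def by blast

lemma connection_add_left:
  "open U \<Longrightarrow> smooth_vf A U X \<Longrightarrow> smooth_vf A U X' \<Longrightarrow> smooth_vf A U Y \<Longrightarrow> p \<in> U \<Longrightarrow>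
    N (\<lambda>q. X q + X' q) Y p = N X Y p + N X' Y p"
  using conn unfolding affine_connection_def by blast

lemma connection_add_right:
  "open U \<Longrightarrow> smooth_vf A U X \<Longrightarrow> smooth_vf A U Y \<Longrightarrow> smooth_vf A U Y' \<Longrightarrow> p \<in> U \<Longrightarrow>
    N X (\<lambda>q. Y q + Y' q) p = N X Y p + N X Y' p"
  using conn unfolding affine_connection_def by blast

lemma connection_scaleR_left:
  "open U \<Longrightarrow> smooth_vf A U X \<Longrightarrow> smooth_vf A U Y \<Longrightarrow> smooth_fun A U f \<Longrightarrow> p \<in> U \<Longrightarrow>
    N (\<lambda>q. f q *\<^sub>R X q) Y p = f p *\<^sub>R N X Y p"
  using conn unfolding affine_connection_def by blast

lemma connection_scaleR_right:
  "open U \<Longrightarrow> smooth_vf A U X \<Longrightarrow> smooth_vf A U Y \<Longrightarrow> smooth_fun A U f \<Longrightarrow> p \<in> U \<Longrightarrow>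
    N X (\<lambda>q. f q *\<^sub>R Y q) p = dir_deriv A p (X p) f *\<^sub>R Y p + f p *\<^sub>R N X Y p"
  using conn unfolding affine_connection_def by blast

text \<open>Locality: a field \<open>Z\<close> that vanishes on \<open>U\<close> equals \<open>f *\<^sub>R Z\<close> for the indicator function \<open>f\<close> of the
  complement of \<open>U\<close>, and \<open>f\<close> is smooth on \<open>U\<close>.\<close>

lemma connection_vanishing:
  assumes U: "open U" "p \<in> U" and Z: "\<And>q. q \<in> U \<Longrightarrow> Z q = 0" and Y: "smooth_vf A U Y"
  shows "N Z Y p = 0" "N Y Z p = 0"
proof -
  define f :: "'a \<Rightarrow> real" where "f = (\<lambda>q. if q \<in> U then 0 else 1)"
  have f: "smooth_fun A U f"
    using smooth_fun_cong[OF atlas U(1), of f "\<lambda>q. 0"] smooth_fun_const[OF atlas]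
    by (simp add: f_def)
  have sZ: "smooth_vf A U Z"
    using smooth_vf_cong[OF atlas U(1), of Z "\<lambda>q. 0"] smooth_vf_zero[OF atlas U(1)] Z by simp
  have fZ: "(\<lambda>q. f q *\<^sub>R Z q) = Z" using Z by (auto simp: f_def)
  show "N Z Y p = 0"
    using connection_scaleR_left[OF U(1) sZ Y f U(2)] U(2) unfolding fZ by (simp add: f_def)
  show "N Y Z p = 0"
    using connection_scaleR_right[OF U(1) Y sZ f U(2)] U(2) Z unfolding fZ by (simp add: f_def)
qed

text \<open>The difference of the two fields vanishes on \<open>U\<close>. This is needed for nested
  derivatives, where the inner field is known on \<open>U\<close> only.\<close>

lemma connection_cong:
  assumes U: "open U" "p \<in> U" and XX': "\<And>q. q \<in> U \<Longrightarrow> X q = X' q"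
    and X: "smooth_vf A U X" and Y: "smooth_vf A U Y"
  shows "N X Y p = N X' Y p" "N Y X p = N Y X' p"
proof -
  define Z where "Z = (\<lambda>q. X' q - X q)"
  have Z0: "Z q = 0" if "q \<in> U" for q using XX' that by (simp add: Z_def)
  have sZ: "smooth_vf A U Z"
    using smooth_vf_cong[OF atlas U(1), of Z "\<lambda>q. 0"] smooth_vf_zero[OF atlas U(1)] Z0 by simp
  have X': "(\<lambda>q. X q + Z q) = X'" by (simp add: Z_def)
  show "N X Y p = N X' Y p"
    using connection_add_left[OF U(1) X sZ Y U(2)] connection_vanishing(1)[OF U Z0 Y]
    unfolding X' by simp
  show "N Y X p = N Y X' p"
    using connection_add_right[OF U(1) Y X sZ U(2)] connection_vanishing(2)[OF U Z0 Y]
    unfolding X' by simp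
qed

lemma connection_axpy_left:
  assumes U: "open U" "p \<in> U" and X: "smooth_vf A U X" and X': "smooth_vf A U X'" and Y: "smooth_vf A U Y"
  shows "N (\<lambda>q. a *\<^sub>R X q + X' q) Y p = a *\<^sub>R N X Y p + N X' Y p"
proof -
  have "smooth_vf A U (\<lambda>q. a *\<^sub>R X q)"
    using smooth_vf_axpy[OF atlas U(1) X smooth_vf_zero[OF atlas U(1)], of a] by simp
  then show ?thesis
    using connection_add_left[OF U(1) _ X' Y U(2), of "\<lambda>q. a *\<^sub>R X q"]
      connection_scaleR_left[OF U(1) X Y smooth_fun_const[OF atlas] U(2)] by simp
qed

lemma connection_axpy_right:
  assumes U: "open U" "p \<in> U" and X: "smooth_vf A U X" and X': "smooth_vf A U X'" and Y: "smooth_vf A U Y"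
  shows "N Y (\<lambda>q. a *\<^sub>R X q + X' q) p = a *\<^sub>R N Y X p + N Y X' p"
proof -
  have "smooth_vf A U (\<lambda>q. a *\<^sub>R X q)"
    using smooth_vf_axpy[OF atlas U(1) X smooth_vf_zero[OF atlas U(1)], of a] by simp
  moreover have "dir_deriv A p v (\<lambda>q. a) = 0" for v
    unfolding dir_deriv_def Let_def by (simp add: o_def)
  ultimately show ?thesis
    using connection_add_right[OF U(1) Y _ X' U(2), of "\<lambda>q. a *\<^sub>R X q"]
      connection_scaleR_right[OF U(1) Y X smooth_fun_const[OF atlas] U(2)] by simp
qed

section \<open>Linearity and skewness of the curvature operator\<close>

lemma curvature_op_skew_left:
  assumes U: "open U" "p \<in> U" and L: "smooth_vf A U (lie_bracket A X Y)" and Z: "smooth_vf A U Z"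
  shows "curvature_op A N Y X Z p = - curvature_op A N X Y Z p"
proof -
  \<comment> \<open>The shape with a factor and a zero summand fits
    \<open>connection_axpy_left\<close>, with the zero field as second field.\<close>
  have "lie_bracket A Y X q = (- 1) *\<^sub>R lie_bracket A X Y q + 0" for q
    unfolding lie_bracket_def Let_def by simp
  then have "lie_bracket A Y X = (\<lambda>q. (- 1) *\<^sub>R lie_bracket A X Y q + 0)" by blast
  then have "N (lie_bracket A Y X) Z p = - N (lie_bracket A X Y) Z p"
    using connection_axpy_left[OF U L smooth_vf_zero[OF atlas U(1)] Z, of "- 1"]
      connection_vanishing(1)[OF U _ Z, of "\<lambda>q. 0"] by simp
  then show ?thesis unfolding curvature_op_def by simp
qed

text \<open>The field \<open>W\<close> is a combination on \<open>U\<close> only, because this is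
  all that holds for the extension of \<open>a *\<^sub>R v + w\<close>.\<close>

lemma curvature_op_axpy_right:
  assumes U: "open U" "p \<in> U" and L: "smooth_vf A U (lie_bracket A X Y)"
    and X: "smooth_vf A U X" and Y: "smooth_vf A U Y" and Z: "smooth_vf A U Z" and Z': "smooth_vf A U Z'"
    and W: "\<And>q. q \<in> U \<Longrightarrow> W q = a *\<^sub>R Z q + Z' q"
  shows "curvature_op A N X Y W p = a *\<^sub>R curvature_op A N X Y Z p + curvature_op A N X Y Z' p"
proof -
  have sW: "smooth_vf A U W"
    using smooth_vf_cong[OF atlas U(1), of W "\<lambda>q. a *\<^sub>R Z q + Z' q"]
      smooth_vf_axpy[OF atlas U(1) Z Z'] W by simp
  have N1: "N T W q = a *\<^sub>R N T Z q + N T Z' q" if "smooth_vf A U T" "q \<in> U" for T q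
    using connection_cong(2)[OF U(1) that(2) W sW that(1)]
      connection_axpy_right[OF U(1) that(2) Z Z' that(1)] by simp
  \<comment> \<open>\<open>N1\<close> holds on all of \<open>U\<close>, not just at
    \<open>p\<close>, so the inner field may be replaced under the outer derivative by
    locality.\<close>
  have N2: "N S (N T W) p = a *\<^sub>R N S (N T Z) p + N S (N T Z') p"
    if "smooth_vf A U T" "smooth_vf A U S" for S T
    using connection_cong(2)[OF U N1[OF that(1)] connection_smooth[OF U(1) that(1) sW] that(2)]
      connection_axpy_right[OF U connection_smooth[OF U(1) that(1) Z]
        connection_smooth[OF U(1) that(1) Z'] that(2)] by simp
  show ?thesis unfolding curvature_op_def
    by (simp add: N2[OF X Y] N2[OF Y X] N1[OF L U(2)] algebra_simps)
qed

context
  fixes g :: "'a \<Rightarrow> real ^ 'n \<Rightarrow> real ^ 'n \<Rightarrow> real"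
  assumes lc: "levi_civita A g N"
begin

lemma torsion_free:
  "open U \<Longrightarrow> smooth_vf A U X \<Longrightarrow> smooth_vf A U Y \<Longrightarrow> p \<in> U \<Longrightarrow>
    lie_bracket A X Y p = (- 1) *\<^sub>R N Y X p + N X Y p"
  using lc unfolding levi_civita_def by (metis scaleR_minus1_left uminus_add_conv_diff)

text \<open>Read off the torsion-free identity, so that no second derivative of a coordinate change is needed.\<close>

lemma smooth_vf_lie_bracket:
  assumes "open U" "smooth_vf A U X" "smooth_vf A U Y"
  shows "smooth_vf A U (lie_bracket A X Y)"
  using smooth_vf_cong[OF atlas assms(1), of "lie_bracket A X Y" "\<lambda>q. (- 1) *\<^sub>R N Y X q + N X Y q"]
    smooth_vf_axpy[OF atlas assms(1) connection_smooth[OF assms(1,3,2)] connection_smooth[OF assms(1,2,3)]]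
    torsion_free[OF assms]
  by blast

lemma curvature_op_axpy_left:
  assumes U: "open U" "p \<in> U"
    and X: "smooth_vf A U X" and X': "smooth_vf A U X'" and Y: "smooth_vf A U Y" and Z: "smooth_vf A U Z"
    and W: "\<And>q. q \<in> U \<Longrightarrow> W q = a *\<^sub>R X q + X' q"
  shows "curvature_op A N W Y Z p = a *\<^sub>R curvature_op A N X Y Z p + curvature_op A N X' Y Z p"
proof -
  have sW: "smooth_vf A U W"
    using smooth_vf_cong[OF atlas U(1), of W "\<lambda>q. a *\<^sub>R X q + X' q"]
      smooth_vf_axpy[OF atlas U(1) X X'] W by simp
  have N1: "N W T q = a *\<^sub>R N X T q + N X' T q" if "smooth_vf A U T" "q \<in> U" for T q
    using connection_cong(1)[OF U(1) that(2) W sW that(1)]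
      connection_axpy_left[OF U(1) that(2) X X' that(1)] by simp
  have N2: "N T W q = a *\<^sub>R N T X q + N T X' q" if "smooth_vf A U T" "q \<in> U" for T q
    using connection_cong(2)[OF U(1) that(2) W sW that(1)]
      connection_axpy_right[OF U(1) that(2) X X' that(1)] by simp
  \<comment> \<open>Through the torsion-free identity the linearity of the bracket is inherited from
    that of \<open>N\<close>; no coordinates are differentiated.\<close>
  have L: "lie_bracket A W Y q = a *\<^sub>R lie_bracket A X Y q + lie_bracket A X' Y q" if "q \<in> U" for q
    using that by (simp add: torsion_free[OF U(1)] X X' Y sW N1 N2 algebra_simps)
  have N3: "N (lie_bracket A W Y) Z p = a *\<^sub>R N (lie_bracket A X Y) Z p + N (lie_bracket A X' Y) Z p"
    using connection_cong(1)[OF U L smooth_vf_lie_bracket[OF U(1) sW Y] Z]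
      connection_axpy_left[OF U smooth_vf_lie_bracket[OF U(1) X Y] smooth_vf_lie_bracket[OF U(1) X' Y] Z]
    by simp
  have N4: "N Y (N W Z) p = a *\<^sub>R N Y (N X Z) p + N Y (N X' Z) p"
    using connection_cong(2)[OF U N1[OF Z] connection_smooth[OF U(1) sW Z] Y]
      connection_axpy_right[OF U connection_smooth[OF U(1) X Z] connection_smooth[OF U(1) X' Z] Y] by simp
  show ?thesis unfolding curvature_op_def
    by (simp add: N3 N4 N1[OF connection_smooth[OF U(1) Y Z] U(2)] algebra_simps)
qed

context
  assumes metric: "riemannian_metric A g"
begin

section \<open>Metric compatibility and the symmetries of the curvature tensor\<close>

lemma metric_symmetric: "g p v w = g p w v"
  and metric_bilinear: "bilinear (g p)"
  using metric unfolding riemannian_metric_def by blast+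

lemma metric_compatible:
  "open U \<Longrightarrow> smooth_vf A U X \<Longrightarrow> smooth_vf A U Y \<Longrightarrow> smooth_vf A U Z \<Longrightarrow> p \<in> U \<Longrightarrow>
    dir_deriv A p (X p) (\<lambda>q. g q (Y q) (Z q)) = g p (N X Y p) (Z p) + g p (Y p) (N X Z p)"
  using lc unfolding levi_civita_def by blast

lemma smooth_fun_metric:
  "open U \<Longrightarrow> smooth_vf A U X \<Longrightarrow> smooth_vf A U Y \<Longrightarrow> smooth_fun A U (\<lambda>p. g p (X p) (Y p))"
  using metric unfolding riemannian_metric_def by blast

text \<open>With \<open>h = g(Z, Z)\<close> and commuting coordinate fields \<open>X\<close>, \<open>Y\<close>, metric compatibility turns
  \<open>2 g(R(X, Y)Z, Z)\<close> into \<open>X(Y h) - Y(X h)\<close>.\<close>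

lemma curvature_op_metric_skew:
  assumes Z: "smooth_vf A (fst (chart_at A p)) Z"
  shows "g p (curvature_op A N (extend_vec A p x) (extend_vec A p y) Z p) (Z p) = 0"
proof -
  define d where "d = chart_at A p"
  define U where "U = fst d"
  define X where "X = extend_vec A p x"
  define Y where "Y = extend_vec A p y"
  define h where "h = (\<lambda>q. g q (Z q) (Z q))"
  have d: "d \<in> A" unfolding d_def by (rule chart_at_mem[OF atlas])
  have p: "p \<in> U" unfolding U_def d_def by (rule point_in_chart_at[OF atlas])
  have U: "open U" unfolding U_def by (rule chart_open[OF atlas d])
  have Z': "smooth_vf A U Z" using Z by (simp add: U_def d_def)
  have X: "smooth_vf A U X" and Y: "smooth_vf A U Y"
    unfolding U_def d_def X_def Y_def by (rule smooth_vf_extend_vec[OF atlas])+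
  have h: "smooth_fun A U h" unfolding h_def by (rule smooth_fun_metric[OF U Z' Z'])
  define H where "H = h \<circ> chart_inv d"
  have op: "open (snd d ` U)" using chart_image_open[OF atlas d U] by (simp add: U_def)
  have H: "smooth_on (snd d ` U) H"
    using h d unfolding smooth_fun_def H_def U_def by (metis Int_absorb)
  have hW: "g q (N W Z q) (Z q) = dir_deriv A q (W q) h / 2" if "smooth_vf A U W" "q \<in> U" for W q
    using metric_compatible[OF U that(1) Z' Z' that(2)] metric_symmetric[of q "Z q"]
    unfolding h_def by simp
  have hE: "g q (N (extend_vec A p v) Z q) (Z q) = frechet_derivative H (at (snd d q)) v / 2"
    if "q \<in> U" for v q
  proof -
    have "smooth_vf A U (extend_vec A p v)"
      unfolding U_def d_def by (rule smooth_vf_extend_vec[OF atlas])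
    from hW[OF this that]
    have "g q (N (extend_vec A p v) Z q) (Z q) = dir_deriv A q (extend_vec A p v q) h / 2" .
    also have "extend_vec A p v q = coord_change d (chart_at A q) q v"
      unfolding extend_vec_def d_def ..
    also have "dir_deriv A q \<dots> h = frechet_derivative H (at (snd d q)) v"
      unfolding H_def
      by (rule dir_deriv_chart[OF atlas d])
        (use that smooth_fun_differentiable[OF atlas h d] in \<open>auto simp: U_def\<close>)
    finally show ?thesis .
  qed
  \<comment> \<open>This is compatibility for the fields \<open>N W Z\<close> and \<open>Z\<close>.
    The subtracted product is symmetric in \<open>v\<close> and \<open>w\<close>, so it cancels in
    the commutator.\<close>
  have second: "g p (N (extend_vec A p v) (N (extend_vec A p w) Z) p) (Z p) =
      frechet_derivative (\<lambda>z. frechet_derivative H (at z) w) (at (snd d p)) v / 2 -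
      g p (N (extend_vec A p w) Z p) (N (extend_vec A p v) Z p)" for v w
  proof -
    let ?V = "extend_vec A p v" and ?W = "extend_vec A p w"
    have V: "smooth_vf A U ?V" and W: "smooth_vf A U ?W"
      unfolding U_def d_def by (rule smooth_vf_extend_vec[OF atlas])+
    let ?f = "\<lambda>q. g q (N ?W Z q) (Z q)"
    have f: "smooth_fun A U ?f" by (rule smooth_fun_metric[OF U connection_smooth[OF U W Z'] Z'])
    let ?F = "\<lambda>z. frechet_derivative H (at z) w"
    have eq: "(?f \<circ> chart_inv d) z = ?F z / 2" if "z \<in> snd d ` U" for z
      using that hE chart_inv_left[OF atlas d] by (auto simp: U_def)
    have Fd: "?F differentiable (at (snd d p))"
      using p by (intro smooth_on_differentiable[OF smooth_on_frechet_derivative[OF H]]) auto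
    have "dir_deriv A p (?V p) ?f = frechet_derivative (?f \<circ> chart_inv d) (at (snd d p)) v"
      using dir_deriv_chart[OF atlas d _ smooth_fun_differentiable[OF atlas f d]] p
      by (simp add: U_def d_def extend_vec_def)
    also have "\<dots> = frechet_derivative (\<lambda>z. ?F z / 2) (at (snd d p)) v"
      by (subst frechet_derivative_cong_open[OF op _ eq]) (use p in auto)
    also have "\<dots> = frechet_derivative ?F (at (snd d p)) v / 2"
      by (rule frechet_derivative_bounded_linear[OF Fd bounded_linear_divide])
    finally show ?thesis
      using metric_compatible[OF U V connection_smooth[OF U W Z'] Z' p] by simp
  qed
  \<comment> \<open>By \<open>hW\<close> only the value of the bracket at \<open>p\<close> matters,
    and that value is zero.\<close>
  have "g p (N (lie_bracket A X Y) Z p) (Z p) = dir_deriv A p 0 h / 2"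
    using hW[OF smooth_vf_lie_bracket[OF U X Y] p] lie_bracket_extend_vec[OF atlas]
    unfolding X_def Y_def by simp
  also have "\<dots> = 0"
    using linear_0[OF linear_frechet_derivative[OF smooth_fun_differentiable[OF atlas h d p]]] p
    unfolding dir_deriv_def Let_def d_def[symmetric] U_def by simp
  finally have "g p (N (lie_bracket A X Y) Z p) (Z p) = 0" .
  moreover have "g p (N X (N Y Z) p) (Z p) = g p (N Y (N X Z) p) (Z p)"
    unfolding X_def Y_def second
    using second_derivative_commute[OF H op, of "snd d p" y x] p
      metric_symmetric[of p "N (extend_vec A p x) Z p" "N (extend_vec A p y) Z p"] by simp
  ultimately show ?thesis
    unfolding curvature_op_def X_def[symmetric] Y_def[symmetric]
    using metric_bilinear[of p] by (simp add: bilinear_lsub)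
qed

lemma curvature_tensor_linear1: "linear (\<lambda>x. curvature_tensor A g N p x y z u)"
  and curvature_tensor_linear3: "linear (\<lambda>z. curvature_tensor A g N p x y z u)"
  and curvature_tensor_skew12: "curvature_tensor A g N p y x z u = - curvature_tensor A g N p x y z u"
  and curvature_tensor_skew34: "curvature_tensor A g N p x y u z = - curvature_tensor A g N p x y z u"
proof -
  define U where "U = fst (chart_at A p)"
  have p: "p \<in> U" unfolding U_def by (rule point_in_chart_at[OF atlas])
  have U: "open U" unfolding U_def by (rule chart_open[OF atlas chart_at_mem[OF atlas]])
  have E: "smooth_vf A U (extend_vec A p v)" for v
    unfolding U_def by (rule smooth_vf_extend_vec[OF atlas])
  have ax: "extend_vec A p (a *\<^sub>R v + w) q = a *\<^sub>R extend_vec A p v q + extend_vec A p w q"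
    if "q \<in> U" for a v w q
    using extend_vec_axpy[OF atlas] that unfolding U_def by blast
  note bil = metric_bilinear[of p, THEN bilinear_ladd] metric_bilinear[of p, THEN bilinear_lmul]
    metric_bilinear[of p, THEN bilinear_lneg]
  have L: "smooth_vf A U (lie_bracket A (extend_vec A p v) (extend_vec A p w))" for v w
    by (rule smooth_vf_lie_bracket[OF U E E])
  show "linear (\<lambda>x. curvature_tensor A g N p x y z u)"
    unfolding curvature_tensor_def
    by (rule linearI_axpy) (simp add: curvature_op_axpy_left[OF U p E E E E ax] bil)
  show lin3: "linear (\<lambda>z. curvature_tensor A g N p x y z u)" for x y u
    unfolding curvature_tensor_def
    by (rule linearI_axpy) (simp add: curvature_op_axpy_right[OF U p L E E E E ax] bil)
  have lin4: "linear (\<lambda>u. curvature_tensor A g N p x y z u)" for x y z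
    using metric_bilinear[of p] unfolding curvature_tensor_def bilinear_def by blast
  show "curvature_tensor A g N p y x z u = - curvature_tensor A g N p x y z u"
    unfolding curvature_tensor_def curvature_op_skew_left[OF U p L E, of y x z] by (simp only: bil)
  \<comment> \<open>The extension of \<open>v\<close> has value \<open>v\<close> at
    \<open>p\<close>, so the diagonal vanishes; polarising with \<open>u + z\<close> gives skewness
    in the last pair.\<close>
  have diag: "curvature_tensor A g N p x y v v = 0" for v
    using curvature_op_metric_skew[OF E[unfolded U_def], of x y v] extend_vec_self[OF atlas, of p v]
    unfolding curvature_tensor_def by simp
  show "curvature_tensor A g N p x y u z = - curvature_tensor A g N p x y z u"
    using diag[of "u + z"] diag[of u] diag[of z] linear_add[OF lin3] linear_add[OF lin4] by simp
qed

end
end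
end


section \<open>Complexification\<close>

definition complexify_vec :: "real ^ 'n \<Rightarrow> complex ^ 'n::finite" where
  "complexify_vec v = (\<chi> i. of_real (v $ i))"

text \<open>The complexified tensors are sums over the standard basis; used slot by slot, this
  identifies them with the original tensors on real vectors.\<close>

lemma linear_vec_expansion:
  fixes f :: "real ^ 'n::finite \<Rightarrow> real"
  assumes "linear f"
  shows "(\<Sum>i\<in>UNIV. v $ i * f (axis i 1)) = f v"
proof -
  have "f (\<Sum>i\<in>UNIV. v $ i *\<^sub>R axis i 1) = (\<Sum>i\<in>UNIV. v $ i * f (axis i 1))"
    using assms by (simp add: linear_sum linear_scale)
  then show ?thesis using basis_expansion[of v] by (simp add: scalar_mult_eq_scaleR)
qed

lemma complexify_form_axpy:
  "complexify_form g (a *s X + Y) Z = a * complexify_form g X Z + complexify_form g Y Z"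
  "complexify_form g Z (a *s X + Y) = a * complexify_form g Z X + complexify_form g Z Y"
  unfolding complexify_form_def
  by (simp_all add: sum.distrib sum_distrib_left ring_distribs mult_ac)

lemma complexify_form_zero: "complexify_form g 0 Z = 0" "complexify_form g Z 0 = 0"
  unfolding complexify_form_def by simp_all

lemma complexify_form_linear:
  "complexify_form g (X + Y) Z = complexify_form g X Z + complexify_form g Y Z"
  "complexify_form g Z (X + Y) = complexify_form g Z X + complexify_form g Z Y"
  "complexify_form g (a *s X) Z = a * complexify_form g X Z"
  "complexify_form g Z (a *s X) = a * complexify_form g Z X"
  using complexify_form_axpy(1)[of g 1 X Y Z] complexify_form_axpy(2)[of g Z 1 X Y]
    complexify_form_axpy(1)[of g a X 0 Z] complexify_form_axpy(2)[of g Z a X 0]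
  by (simp_all add: complexify_form_zero)

lemma complexify_form_real:
  assumes "bilinear g"
  shows "complexify_form g (complexify_vec v) (complexify_vec w) = of_real (g v w)"
proof -
  have l: "linear (g x)" "linear (\<lambda>x. g x y)" for x y using assms unfolding bilinear_def by auto
  have "complexify_form g (complexify_vec v) (complexify_vec w) =
      of_real (\<Sum>i\<in>UNIV. v $ i * (\<Sum>j\<in>UNIV. w $ j * g (axis i 1) (axis j 1)))"
    unfolding complexify_form_def complexify_vec_def by (simp add: sum_distrib_left mult.assoc)
  also have "\<dots> = of_real (g v w)"
    by (simp only: linear_vec_expansion[OF l(1)] linear_vec_expansion[OF l(2)])
  finally show ?thesis .
qed

lemma complexify_form_sym:
  assumes "\<And>v w. g v w = g w v"
  shows "complexify_form g X Y = complexify_form g Y X"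
  unfolding complexify_form_def
  by (subst sum.swap, intro sum.cong refl) (metis assms mult.commute)

lemma complexify_endo_linear:
  "complexify_endo J (X + Y) = complexify_endo J X + complexify_endo J Y"
  "complexify_endo J (a *s X) = a *s complexify_endo J X"
  unfolding complexify_endo_def
  by (simp_all add: vec_eq_iff sum.distrib sum_distrib_left ring_distribs mult_ac)

lemma complexify_endo_real:
  assumes "linear J"
  shows "complexify_endo J (complexify_vec v) = complexify_vec (J v)"
proof -
  have "(\<Sum>i\<in>UNIV. v $ i * J (axis i 1) $ k) = J v $ k" for k
    by (rule linear_vec_expansion[of "\<lambda>v. J v $ k"])
      (use assms linear_compose[OF assms, of "\<lambda>v. v $ k"] in
        \<open>simp add: o_def bounded_linear.linear[OF bounded_linear_vec_nth]\<close>)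
  then show ?thesis unfolding complexify_endo_def complexify_vec_def
    by (simp add: vec_eq_iff of_real_mult[symmetric] of_real_sum[symmetric] del: of_real_mult of_real_sum)
qed

lemma complexify_tensor4_linear:
  "complexify_tensor4 R (X + X') Y Z U = complexify_tensor4 R X Y Z U + complexify_tensor4 R X' Y Z U"
  "complexify_tensor4 R Y (X + X') Z U = complexify_tensor4 R Y X Z U + complexify_tensor4 R Y X' Z U"
  "complexify_tensor4 R Y Z (X + X') U = complexify_tensor4 R Y Z X U + complexify_tensor4 R Y Z X' U"
  "complexify_tensor4 R Y Z U (X + X') = complexify_tensor4 R Y Z U X + complexify_tensor4 R Y Z U X'"
  "complexify_tensor4 R (a *s X) Y Z U = a * complexify_tensor4 R X Y Z U"
  "complexify_tensor4 R Y (a *s X) Z U = a * complexify_tensor4 R Y X Z U"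
  "complexify_tensor4 R Y Z (a *s X) U = a * complexify_tensor4 R Y Z X U"
  "complexify_tensor4 R Y Z U (a *s X) = a * complexify_tensor4 R Y Z U X"
  unfolding complexify_tensor4_def
  by (simp_all add: sum.distrib sum_distrib_left ring_distribs mult_ac)

lemma complexify_tensor4_real:
  assumes "\<And>y z u. linear (\<lambda>x. R x y z u)" "\<And>x z u. linear (\<lambda>y. R x y z u)"
    "\<And>x y u. linear (\<lambda>z. R x y z u)" "\<And>x y z. linear (\<lambda>u. R x y z u)"
  shows "complexify_tensor4 R (complexify_vec x) (complexify_vec y) (complexify_vec z) (complexify_vec u) =
    of_real (R x y z u)"
proof -
  have "complexify_tensor4 R (complexify_vec x) (complexify_vec y) (complexify_vec z) (complexify_vec u) =
      of_real (\<Sum>i\<in>UNIV. x $ i * (\<Sum>j\<in>UNIV. y $ j * (\<Sum>k\<in>UNIV. z $ k *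
        (\<Sum>l\<in>UNIV. u $ l * R (axis i 1) (axis j 1) (axis k 1) (axis l 1)))))"
    unfolding complexify_tensor4_def complexify_vec_def by (simp add: sum_distrib_left mult.assoc)
  also have "\<dots> = of_real (R x y z u)"
    by (simp only: linear_vec_expansion[OF assms(4)] linear_vec_expansion[OF assms(3)]
      linear_vec_expansion[OF assms(2)] linear_vec_expansion[OF assms(1)])
  finally show ?thesis .
qed

lemma complexify_tensor4_skew12:
  assumes "\<And>x y z u. R y x z u = - R x y z u"
  shows "complexify_tensor4 R Y X Z U = - complexify_tensor4 R X Y Z U"
proof -
  have "complexify_tensor4 R Y X Z U = (\<Sum>j\<in>UNIV. \<Sum>i\<in>UNIV. \<Sum>k\<in>UNIV. \<Sum>l\<in>UNIV.
      Y $ i * X $ j * Z $ k * U $ l * of_real (R (axis i 1) (axis j 1) (axis k 1) (axis l 1)))"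
    unfolding complexify_tensor4_def by (rule sum.swap)
  also have "\<dots> = (\<Sum>j\<in>UNIV. \<Sum>i\<in>UNIV. \<Sum>k\<in>UNIV. \<Sum>l\<in>UNIV.
      - (X $ j * Y $ i * Z $ k * U $ l * of_real (R (axis j 1) (axis i 1) (axis k 1) (axis l 1))))"
    by (intro sum.cong refl, subst assms) (simp add: mult.commute mult.left_commute)
  finally show ?thesis unfolding complexify_tensor4_def by (simp add: sum_negf)
qed

lemma complexify_tensor4_skew34:
  assumes "\<And>x y z u. R x y u z = - R x y z u"
  shows "complexify_tensor4 R X Y U Z = - complexify_tensor4 R X Y Z U"
proof -
  have "complexify_tensor4 R X Y U Z = (\<Sum>i\<in>UNIV. \<Sum>j\<in>UNIV. \<Sum>l\<in>UNIV. \<Sum>k\<in>UNIV.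
      X $ i * Y $ j * U $ k * Z $ l * of_real (R (axis i 1) (axis j 1) (axis k 1) (axis l 1)))"
    unfolding complexify_tensor4_def by (intro sum.cong refl sum.swap)
  also have "\<dots> = (\<Sum>i\<in>UNIV. \<Sum>j\<in>UNIV. \<Sum>l\<in>UNIV. \<Sum>k\<in>UNIV.
      - (X $ i * Y $ j * Z $ l * U $ k * of_real (R (axis i 1) (axis j 1) (axis l 1) (axis k 1))))"
    by (intro sum.cong refl, subst assms) (simp add: mult.commute mult.left_commute)
  finally show ?thesis unfolding complexify_tensor4_def by (simp add: sum_negf)
qed

section \<open>Complex planes and their sectional curvature\<close>

lemma in_vec_span_pair:
  "Z \<in> vec.span {X, Y} \<longleftrightarrow> (\<exists>a b. Z = a *s X + b *s Y)" for X Y Z :: "complex ^ 'n::finite"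
proof
  assume "Z \<in> vec.span {X, Y}"
  then obtain a b where "Z - a *s X = b *s Y"
    unfolding vec.span_insert[of X] vec.span_singleton by auto
  then have "Z = a *s X + b *s Y" by (simp add: algebra_simps)
  then show "\<exists>a b. Z = a *s X + b *s Y" by blast
next
  assume "\<exists>a b. Z = a *s X + b *s Y"
  then show "Z \<in> vec.span {X, Y}" by (metis insertI1 insertI2 vec.span_add vec.span_base vec.span_scale)
qed

text \<open>Pairing a combination of \<open>X\<close> and \<open>Y\<close> with \<open>X\<close> and
  with \<open>Y\<close> returns its coefficients, so the form is nondegenerate on the span.
  Perpendicularity to the image under \<open>J\<close> need be checked on generators only, by
  complex linearity.\<close>

lemma nondeg_antiholomorphic_orthonormal:
  fixes X Y :: "complex ^ 'n::finite"
  assumes sym: "\<And>v w. g v w = g w v"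
    and G: "complexify_form g X X = 1" "complexify_form g Y Y = 1" "complexify_form g X Y = 0"
    and J: "\<And>V W. V \<in> {X, Y} \<Longrightarrow> W \<in> {X, Y} \<Longrightarrow> complexify_form g V (complexify_endo J W) = 0"
  shows "nondeg_antiholomorphic_cplane g J (vec.span {X, Y})"
proof -
  have YX: "complexify_form g Y X = 0" using G(3) complexify_form_sym[of g Y X, OF sym] by simp
  have "X \<noteq> Y" "Y \<noteq> 0" using G by (auto simp: complexify_form_zero)
  moreover have "X \<notin> vec.span {Y}"
  proof
    assume "X \<in> vec.span {Y}"
    then obtain k where "X = k *s Y" by (auto simp: vec.span_singleton)
    then show False using G by (auto simp: complexify_form_linear)
  qed
  ultimately have ind: "vec.independent {X, Y}" "card {X, Y} = 2"
    by (auto simp: vec.independent_insert)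
  have nondeg: "Z = 0" if Z: "Z \<in> vec.span {X, Y}" "\<forall>W\<in>vec.span {X, Y}. complexify_form g Z W = 0" for Z
  proof -
    obtain a b where Zab: "Z = a *s X + b *s Y" using Z(1) in_vec_span_pair by blast
    have "complexify_form g Z X = 0" "complexify_form g Z Y = 0"
      using Z(2) by (auto simp: vec.span_base)
    then show ?thesis unfolding Zab by (simp add: complexify_form_linear G YX)
  qed
  have "complexify_form g V W = 0"
    if V: "V \<in> vec.span {X, Y}" and W: "W \<in> complexify_endo J ` vec.span {X, Y}" for V W
  proof -
    obtain a b c d where "V = a *s X + b *s Y" "W = complexify_endo J (c *s X + d *s Y)"
      using V W in_vec_span_pair by (metis imageE)
    then show ?thesis by (simp add: complexify_form_linear complexify_endo_linear J)
  qed
  then show ?thesis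
    unfolding nondeg_antiholomorphic_cplane_def
    using vec.dim_span_eq_card_independent[OF ind(1), unfolded ind(2)] nondeg
      vec.subspace_span[of "{X, Y}"] by blast
qed

text \<open>The curvature is a definite description, so independence of the basis has to be shown:
  numerator and denominator both scale with the square of the determinant of the change of
  basis.\<close>

lemma complex_sectional_curvature_orthonormal:
  fixes X Y :: "complex ^ 'n::finite"
  assumes sym: "\<And>v w. g v w = g w v"
    and G: "complexify_form g X X = 1" "complexify_form g Y Y = 1" "complexify_form g X Y = 0"
    and R12: "\<And>x y z u. R y x z u = - R x y z u"
    and R34: "\<And>x y z u. R x y u z = - R x y z u"
  shows "complex_sectional_curvature g R (vec.span {X, Y}) = complexify_tensor4 R X Y Y X"
  unfolding complex_sectional_curvature_def
proof (rule the_equality)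
  show "\<exists>X' Y'. vec.span {X', Y'} = vec.span {X, Y} \<and>
      complexify_tensor4 R X Y Y X = complexify_tensor4 R X' Y' Y' X' /
        (complexify_form g X' X' * complexify_form g Y' Y' - (complexify_form g X' Y')\<^sup>2)"
    by (rule exI[of _ X], rule exI[of _ Y]) (simp add: G)
next
  let ?T = "complexify_tensor4 R" and ?g = "complexify_form g"
  have YX: "?g Y X = 0" using G(3) complexify_form_sym[of g Y X, OF sym] by simp
  fix k assume "\<exists>X' Y'. vec.span {X', Y'} = vec.span {X, Y} \<and>
      k = ?T X' Y' Y' X' / (?g X' X' * ?g Y' Y' - (?g X' Y')\<^sup>2)"
  then obtain X' Y' where span: "vec.span {X', Y'} = vec.span {X, Y}"
    and k: "k = ?T X' Y' Y' X' / (?g X' X' * ?g Y' Y' - (?g X' Y')\<^sup>2)" by (elim exE conjE)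
  have in_span: "X' \<in> vec.span {X, Y}" "Y' \<in> vec.span {X, Y}"
    using vec.span_base[of X' "{X', Y'}"] vec.span_base[of Y' "{X', Y'}"] unfolding span by simp_all
  obtain a b where X': "X' = a *s X + b *s Y"
    using in_vec_span_pair[THEN iffD1, OF in_span(1)] by blast
  obtain c d where Y': "Y' = c *s X + d *s Y"
    using in_vec_span_pair[THEN iffD1, OF in_span(2)] by blast
  have in_span': "X \<in> vec.span {X', Y'}" "Y \<in> vec.span {X', Y'}"
    using vec.span_base[of X "{X, Y}"] vec.span_base[of Y "{X, Y}"] unfolding span by simp_all
  obtain p q where X: "X = p *s X' + q *s Y'"
    using in_vec_span_pair[THEN iffD1, OF in_span'(1)] by blast
  obtain r s where Y: "Y = r *s X' + s *s Y'"
    using in_vec_span_pair[THEN iffD1, OF in_span'(2)] by blast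
  \<comment> \<open>Pairing the expansions of \<open>X\<close> and \<open>Y\<close> with
    \<open>X\<close> and \<open>Y\<close> themselves shows that the coefficient matrices in the two
    directions are inverse to each other; hence the determinant is nonzero.\<close>
  have exp: "?g (u *s X' + v *s Y') X = u * a + v * c" "?g (u *s X' + v *s Y') Y = u * b + v * d" for u v
    by (simp_all add: X' Y' complexify_form_linear G YX algebra_simps)
  have "?g X X = p * a + q * c" "?g X Y = p * b + q * d" "?g Y X = r * a + s * c" "?g Y Y = r * b + s * d"
    using exp[of p q] exp[of r s] unfolding X[symmetric] Y[symmetric] by simp_all
  then have "p * a + q * c = 1" "p * b + q * d = 0" "r * a + s * c = 0" "r * b + s * d = 1"
    using G YX by simp_all
  then have "(p * s - q * r) * (a * d - b * c) = 1" by algebra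
  then have D: "a * d - b * c \<noteq> 0" by auto
  have diag: "?T V V Z W = 0" "?T Z W V V = 0" for V Z W
    using complexify_tensor4_skew12[of R V V Z W, OF R12] complexify_tensor4_skew34[of R Z W V V, OF R34]
    by simp_all
  have "?T X' Y' Z W = (a * d - b * c) * ?T X Y Z W" for Z W
    using complexify_tensor4_skew12[of R Y X Z W, OF R12]
    by (simp add: X' Y' complexify_tensor4_linear diag algebra_simps)
  moreover have "?T Z W Y' X' = (a * d - b * c) * ?T Z W Y X" for Z W
    using complexify_tensor4_skew34[of R Z W X Y, OF R34]
    by (simp add: X' Y' complexify_tensor4_linear diag algebra_simps)
  ultimately have "?T X' Y' Y' X' = (a * d - b * c)\<^sup>2 * ?T X Y Y X"
    by (simp add: power2_eq_square)
  moreover have "?g X' X' * ?g Y' Y' - (?g X' Y')\<^sup>2 = (a * d - b * c)\<^sup>2"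
    by (simp add: X' Y' complexify_form_linear G YX) algebra
  ultimately show "k = ?T X Y Y X" using k D by simp
qed


section \<open>Antiholomorphic planes\<close>

text \<open>For positive \<open>d\<close> the value of \<open>s\<close> is chosen so that
  \<open>s\<^sup>2 * d\<close> is \<open>\<bar>e - c\<bar> + 1\<close>, which overshoots the
  bound.\<close>

lemma quadratic_bounded_above:
  fixes c d e :: real
  assumes "\<And>s. c + s\<^sup>2 * d \<le> e"
  shows "d \<le> 0"
proof (rule ccontr)
  assume "\<not> d \<le> 0"
  then have d: "d > 0" by simp
  have "(sqrt ((\<bar>e - c\<bar> + 1) / d))\<^sup>2 * d = \<bar>e - c\<bar> + 1" using d by simp
  then show False using assms[of "sqrt ((\<bar>e - c\<bar> + 1) / d)"] by linarith
qed

text \<open>The coefficient of \<open>d\<close> is odd in \<open>s\<close> and at least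
  \<open>s\<^sup>2\<close> in absolute value. Giving \<open>s\<close> the sign of \<open>d\<close>
  turns the bound into one on a quadratic with coefficient \<open>\<bar>d\<bar>\<close>.\<close>

lemma odd_bounded_above:
  fixes d e :: real
  assumes "\<And>s. s * sqrt (1 + s\<^sup>2) * d \<le> e"
  shows "d = 0"
proof -
  have "0 + s\<^sup>2 * \<bar>d\<bar> \<le> e" for s
  proof -
    have "\<bar>s\<bar> \<le> sqrt (1 + s\<^sup>2)" by (rule real_le_rsqrt) simp
    then have "\<bar>s\<bar> * \<bar>s\<bar> \<le> \<bar>s\<bar> * sqrt (1 + s\<^sup>2)" by (intro mult_left_mono) auto
    then have "s\<^sup>2 * \<bar>d\<bar> \<le> \<bar>s\<bar> * sqrt (1 + s\<^sup>2) * \<bar>d\<bar>"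
      by (intro mult_right_mono) (simp_all add: power2_eq_square)
    also have "\<dots> \<le> e"
      using assms[of "\<bar>s\<bar>"] assms[of "- \<bar>s\<bar>"] by (cases "d \<ge> 0") auto
    finally show ?thesis by simp
  qed
  then have "\<bar>d\<bar> \<le> 0" by (rule quadratic_bounded_above)
  then show ?thesis by simp
qed

text \<open>Orthonormality for the Hermitian form \<open>g x y + i g x (J y)\<close>. The other
  products with \<open>J\<close> vanish because \<open>J\<close> is skew for \<open>g\<close>, so
  such a pair spans an antiholomorphic plane.\<close>

definition unitary_pair ::
  "(real ^ 'n \<Rightarrow> real ^ 'n \<Rightarrow> real) \<Rightarrow> (real ^ 'n \<Rightarrow> real ^ 'n) \<Rightarrow> real ^ 'n \<Rightarrow> real ^ 'n::finite \<Rightarrow> bool" where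
  "unitary_pair g J x y \<longleftrightarrow> g x x = 1 \<and> g y y = 1 \<and> g x y = 0 \<and> g x (J y) = 0"

context
  fixes g :: "real ^ 'n \<Rightarrow> real ^ 'n \<Rightarrow> real"
  assumes g_bilinear: "bilinear g" and g_sym: "\<And>v w. g v w = g w v"
    and g_pos: "\<And>v. v \<noteq> 0 \<Longrightarrow> g v v > 0"
begin

lemmas g_simps = bilinear_ladd[OF g_bilinear] bilinear_radd[OF g_bilinear]
  bilinear_lmul[OF g_bilinear] bilinear_rmul[OF g_bilinear]
  bilinear_lneg[OF g_bilinear] bilinear_rneg[OF g_bilinear]
  bilinear_lsub[OF g_bilinear] bilinear_rsub[OF g_bilinear]

section \<open>Orthonormal vectors and real sectional curvature\<close>

text \<open>Each functional \<open>g s\<close> is a Euclidean inner product with some vector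
  \<open>f s\<close>. Too few of these to span leave a Euclidean normal direction, which is then
  normalised with \<open>g\<close>.\<close>

lemma exists_unit_orthogonal:
  assumes "finite S" "card S < CARD('n)"
  obtains z where "g z z = 1" "\<And>s. s \<in> S \<Longrightarrow> g s z = 0"
proof -
  define f where "f = (\<lambda>s. (\<chi> i. g s (axis i 1)) :: real ^ 'n)"
  have f: "g s z = f s \<bullet> z" for s z
    using linear_vec_expansion[of "g s" z] g_bilinear
    by (simp add: bilinear_def f_def inner_vec_def mult.commute)
  have "dim (f ` S) \<le> card (f ` S)" using assms(1) by (intro dim_le_card') auto
  also have "\<dots> \<le> card S" using assms(1) by (rule card_image_le)
  finally have "dim (f ` S) < DIM(real ^ 'n)" using assms(2) by simp
  from orthogonal_to_subspace_exists[OF this] obtain v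
    where v: "v \<noteq> 0" "\<And>y. y \<in> span (f ` S) \<Longrightarrow> orthogonal v y" by blast
  define z where "z = (1 / sqrt (g v v)) *\<^sub>R v"
  have "g z z = 1" using g_pos[OF v(1)] by (simp add: z_def g_simps)
  moreover have "g s z = 0" if "s \<in> S" for s
    using v(2)[of "f s"] that by (simp add: z_def g_simps f span_base orthogonal_def inner_commute)
  ultimately show ?thesis using that by blast
qed

lemma orthonormal_span:
  assumes "subspace \<alpha>" "dim \<alpha> = 2" "x \<in> \<alpha>" "y \<in> \<alpha>" "g x x = 1" "g y y = 1" "g x y = 0"
  shows "span {x, y} = \<alpha>"
proof -
  have ne: "x \<noteq> y" "y \<noteq> 0" using assms bilinear_lzero[OF g_bilinear] by auto
  have "x \<notin> span {y}"
  proof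
    assume "x \<in> span {y}"
    then obtain k where "x = k *\<^sub>R y" by (auto simp: span_singleton)
    then show False using assms by (auto simp: g_simps)
  qed
  then have ind: "independent {x, y}" using ne by (simp add: independent_insert)
  have "\<alpha> \<subseteq> span {x, y}"
    using card_eq_dim[of "{x, y}" \<alpha>] ind assms ne by auto
  then show ?thesis using span_minimal[of "{x, y}" \<alpha>] assms by auto
qed

lemma exists_orthonormal_basis:
  assumes "subspace \<alpha>" "dim \<alpha> = 2"
  obtains x y where "x \<in> \<alpha>" "y \<in> \<alpha>" "g x x = 1" "g y y = 1" "g x y = 0"
proof -
  obtain B where B: "B \<subseteq> \<alpha>" "independent B" "card B = 2"
    using basis_exists[of \<alpha>] assms by metis
  then obtain a b where ab: "B = {a, b}" "a \<noteq> b" by (meson card_2_iff)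
  have a: "a \<noteq> 0" using B ab dependent_zero by blast
  have b: "b \<notin> span {a}" using B(2) ab independent_insert[of b "{a}"] by (simp add: insert_commute)
  define x where "x = (1 / sqrt (g a a)) *\<^sub>R a"
  define w where "w = b - g b x *\<^sub>R x"
  define y where "y = (1 / sqrt (g w w)) *\<^sub>R w"
  have xa: "x \<in> span {a}" by (simp add: x_def span_base span_mul)
  have w: "w \<noteq> 0" using b xa by (metis eq_iff_diff_eq_0 span_mul w_def)
  have x1: "g x x = 1" using g_pos[OF a] by (simp add: x_def g_simps)
  have y1: "g y y = 1" using g_pos[OF w] by (simp add: y_def g_simps)
  have "g x w = 0" by (simp add: w_def g_simps x1 g_sym[of x b])
  then have "g x y = 0" by (simp add: y_def g_simps)
  moreover have "x \<in> \<alpha>" using assms B ab by (simp add: x_def subspace_mul)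
  moreover have "y \<in> \<alpha>" using assms B ab \<open>x \<in> \<alpha>\<close>
    by (simp add: y_def w_def subspace_mul subspace_diff)
  ultimately show ?thesis using that x1 y1 by blast
qed

text \<open>A common value on all orthonormal bases of the plane yields both uniqueness in the
  definite description and its value; existence is Gram-Schmidt.\<close>

lemma sectional_curvature_orthonormal:
  assumes "subspace \<alpha>" "dim \<alpha> = 2"
    and k: "\<And>x y. x \<in> \<alpha> \<Longrightarrow> y \<in> \<alpha> \<Longrightarrow> g x x = 1 \<Longrightarrow> g y y = 1 \<Longrightarrow> g x y = 0 \<Longrightarrow> R x y y x = k"
  shows "sectional_curvature g R \<alpha> = k"
  unfolding sectional_curvature_def
proof (rule the_equality)
  obtain x y where xy: "x \<in> \<alpha>" "y \<in> \<alpha>" "g x x = 1" "g y y = 1" "g x y = 0"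
    using exists_orthonormal_basis[OF assms(1,2)] by blast
  show "\<exists>x y. span {x, y} = \<alpha> \<and> g x x = 1 \<and> g y y = 1 \<and> g x y = 0 \<and> k = R x y y x"
    using orthonormal_span[OF assms(1,2) xy] k[OF xy] xy by metis
next
  fix l assume "\<exists>x y. span {x, y} = \<alpha> \<and> g x x = 1 \<and> g y y = 1 \<and> g x y = 0 \<and> l = R x y y x"
  then obtain x y where xy: "span {x, y} = \<alpha>" "g x x = 1" "g y y = 1" "g x y = 0" "l = R x y y x"
    by blast
  have "x \<in> \<alpha>" "y \<in> \<alpha>" using xy(1) span_base[of _ "{x, y}"] by auto
  then show "l = k" using k xy by simp
qed

context
  fixes J :: "real ^ 'n \<Rightarrow> real ^ 'n"
    and R :: "real ^ 'n \<Rightarrow> real ^ 'n \<Rightarrow> real ^ 'n \<Rightarrow> real ^ 'n \<Rightarrow> real"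
  assumes J_linear: "linear J" and J_J: "\<And>v. J (J v) = - v" and J_g: "\<And>v w. g (J v) (J w) = g v w"
    and R_linear1: "\<And>y z u. linear (\<lambda>x. R x y z u)"
    and R_linear3: "\<And>x y u. linear (\<lambda>z. R x y z u)"
    and R_skew12: "\<And>x y z u. R y x z u = - R x y z u"
    and R_skew34: "\<And>x y z u. R x y u z = - R x y z u"
begin

section \<open>Algebra of unitary pairs and of the curvature\<close>

lemmas J_simps = linear_add[OF J_linear] linear_scale[OF J_linear] linear_neg[OF J_linear]
  linear_diff[OF J_linear] J_J

lemma J_skew: "g (J x) y = - g x (J y)"
  using J_g[of x "J y"] by (simp add: g_simps J_simps)

lemma g_J_self: "g x (J x) = 0"
  using J_skew[of x x] g_sym[of x "J x"] by simp

lemma unitary_pair_sym: "unitary_pair g J x y \<Longrightarrow> unitary_pair g J y x"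
  unfolding unitary_pair_def using J_skew[of x y] by (metis g_sym neg_equal_0_iff_equal)

lemma R_linear2: "linear (\<lambda>y. R x y z u)" and R_linear4: "linear (\<lambda>u. R x y z u)"
proof -
  have "linear (\<lambda>y. - R y x z u)" "linear (\<lambda>u. - R x y u z)"
    by (intro linear_compose_neg R_linear1 R_linear3)+
  moreover have "(\<lambda>y. - R y x z u) = (\<lambda>y. R x y z u)" using R_skew12 by metis
  moreover have "(\<lambda>u. - R x y u z) = (\<lambda>u. R x y z u)" using R_skew34 by metis
  ultimately show "linear (\<lambda>y. R x y z u)" "linear (\<lambda>u. R x y z u)" by simp_all
qed

lemmas R_simps = linear_add[OF R_linear1] linear_add[OF R_linear2] linear_add[OF R_linear3]
  linear_add[OF R_linear4] linear_scale[OF R_linear1] linear_scale[OF R_linear2]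
  linear_scale[OF R_linear3] linear_scale[OF R_linear4]

lemma R_diag: "R x x z u = 0" "R x y z z = 0"
  using R_skew12[of x x] R_skew34[of x y z z] by simp_all

text \<open>An alternating pair of slots depends only on the bivector, so a change of basis
  contributes its determinant.\<close>

lemma R_wedge12: "R (a *\<^sub>R x + b *\<^sub>R z) (c *\<^sub>R x + d *\<^sub>R z) u v = (a * d - b * c) * R x z u v"
  using R_skew12[of x z u v] by (simp add: R_simps R_diag algebra_simps)

lemma R_wedge34: "R u v (a *\<^sub>R x + b *\<^sub>R z) (c *\<^sub>R x + d *\<^sub>R z) = (a * d - b * c) * R u v x z"
  using R_skew34[of u v x z] by (simp add: R_simps R_diag algebra_simps)

lemma curvature_rotate:
  assumes "c\<^sup>2 + s\<^sup>2 = 1"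
  shows "R (c *\<^sub>R x + s *\<^sub>R z) ((- s) *\<^sub>R x + c *\<^sub>R z) ((- s) *\<^sub>R x + c *\<^sub>R z) (c *\<^sub>R x + s *\<^sub>R z) = R x z z x"
proof -
  \<comment> \<open>The two determinants. The second pair of slots lists the rotated vectors in
    reverse order, hence the sign.\<close>
  have "c * c - s * (- s) = 1" "(- s) * s - c * c = - 1"
    using assms by (simp_all add: power2_eq_square)
  then show ?thesis using R_skew34[of x z x z] unfolding R_wedge12 R_wedge34 by simp
qed

lemma curvature_sym: "R x y y x = R y x x y"
  using R_skew12[of x y] R_skew34[of y x y x] by simp

lemma unitary_pair_combine:
  assumes "unitary_pair g J x y" "unitary_pair g J z y" "unitary_pair g J x z" "c\<^sup>2 + s\<^sup>2 = 1"
  shows "unitary_pair g J (c *\<^sub>R x + s *\<^sub>R z) y"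
    "unitary_pair g J (c *\<^sub>R x + s *\<^sub>R z) ((- s) *\<^sub>R x + c *\<^sub>R z)"
  using assms unitary_pair_sym[OF assms(3)]
  unfolding unitary_pair_def
  by (simp_all add: g_simps J_simps g_J_self power2_eq_square algebra_simps)

lemma curvature_constant:
  assumes dim: "CARD('n) > 4"
    and eq: "\<And>x y z. unitary_pair g J x y \<Longrightarrow> unitary_pair g J y z \<Longrightarrow> unitary_pair g J x z \<Longrightarrow>
      R x y y x = R z y y z"
  shows "\<exists>k. \<forall>x y. unitary_pair g J x y \<longrightarrow> R x y y x = k"
proof -
  define K where "K x y = R x y y x" for x y
  note us = unitary_pair_sym
  have K_sym: "K x y = K y x" for x y unfolding K_def by (rule curvature_sym)
  have K_eq: "K x y = K x z" if "unitary_pair g J x y" "unitary_pair g J y z" "unitary_pair g J x z" for x y z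
    using eq[of y x z] that us K_sym unfolding K_def by metis
  have orth: "\<exists>z. unitary_pair g J x z \<and> unitary_pair g J y z" if "g x x = 1" "g y y = 1" for x y
  proof -
    \<comment> \<open>A unit vector orthogonal to these four is a unitary neighbour of both
      \<open>x\<close> and \<open>y\<close>; here more than four dimensions are required.\<close>
    have "card {x, J x, y, J y} \<le> 4" by (intro card_insert_le_m1) auto
    then have "card {x, J x, y, J y} < CARD('n)" using dim by linarith
    from exists_unit_orthogonal[OF _ this] obtain z
      where z: "g z z = 1" "\<And>s. s \<in> {x, J x, y, J y} \<Longrightarrow> g s z = 0" by blast
    have "g x z = 0" "g (J x) z = 0" "g y z = 0" "g (J y) z = 0" using z(2) by auto
    then show ?thesis using z(1) that J_skew[of _ z] unfolding unitary_pair_def by force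
  qed
  have rotate: "K (c *\<^sub>R x + s *\<^sub>R z) y = K x y"
    if h: "unitary_pair g J x y" "unitary_pair g J z y" "unitary_pair g J x z" "c\<^sup>2 + s\<^sup>2 = 1" for x y z c s
  proof -
    let ?x = "c *\<^sub>R x + s *\<^sub>R z" and ?z = "(- s) *\<^sub>R x + c *\<^sub>R z"
    have "unitary_pair g J ?z y"
      using unitary_pair_combine(1)[OF h(1-3), of "- s" c] h(4) by (simp add: add.commute)
    then have "K ?x y = K ?x ?z"
      using unitary_pair_combine[OF h] us K_eq by blast
    also have "\<dots> = K x z" unfolding K_def by (rule curvature_rotate[OF h(4)])
    also have "\<dots> = K x y" using K_eq h us by blast
    finally show ?thesis .
  qed
  have phase: "unitary_pair g J x (c *\<^sub>R y + s *\<^sub>R J y)" "K x (c *\<^sub>R y + s *\<^sub>R J y) = K x y"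
    if h: "unitary_pair g J x y" "c\<^sup>2 + s\<^sup>2 = 1" for x y c s
  proof -
    let ?y = "c *\<^sub>R y + s *\<^sub>R J y"
    have up: "unitary_pair g J w ?y" if "unitary_pair g J w y" for w
      using that h(2) g_J_self[of y] g_sym[of y "J y"] unfolding unitary_pair_def
      by (simp add: g_simps J_simps J_g power2_eq_square algebra_simps)
    show "unitary_pair g J x ?y" using up h by blast
    obtain z where z: "unitary_pair g J x z" "unitary_pair g J y z"
      using orth[of x y] h unfolding unitary_pair_def by blast
    \<comment> \<open>The auxiliary \<open>z\<close> is unitary to \<open>y\<close>, hence to
      \<open>J y\<close> and to \<open>?y\<close> as well, so it forms a triple with
      \<open>x\<close> and either of \<open>y\<close> and \<open>?y\<close>.\<close>
    have "K x ?y = K x z" using K_eq up z h us by blast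
    also have "\<dots> = K x y" using K_eq z h us by metis
    finally show "K x ?y = K x y" .
  qed
  have real_indep: "K x y = K x w" if h: "unitary_pair g J x y" "unitary_pair g J x w" "g y (J w) = 0" for x y w
  proof -
    let ?a = "g y w"
    \<comment> \<open>Gram-Schmidt of \<open>w\<close> against \<open>y\<close>. As
      \<open>g y (J w)\<close> vanishes, the normalised remainder completes \<open>x\<close> and
      \<open>y\<close> to a triple and \<open>w\<close> is a rotation of \<open>y\<close> in it; if
      the remainder is zero, \<open>w\<close> is \<open>y\<close> up to sign.\<close>
    define v where "v = w - ?a *\<^sub>R y"
    have gyy: "g y y = 1" "g w w = 1" using h unfolding unitary_pair_def by auto
    have vv: "g v v = 1 - ?a\<^sup>2"
      using gyy g_sym[of w y] by (simp add: v_def g_simps power2_eq_square algebra_simps)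
    show ?thesis
    proof (cases "v = 0")
      case True
      then have "?a * ?a = 1" using vv bilinear_lzero[OF g_bilinear] by (simp add: power2_eq_square)
      moreover have "w = ?a *\<^sub>R y" using True by (simp add: v_def)
      moreover have "K x (a *\<^sub>R y) = a * a * K x y" for a unfolding K_def by (simp add: R_simps)
      ultimately show ?thesis by (metis mult_1)
    next
      case False
      define b where "b = sqrt (g v v)"
      define z where "z = (1 / b) *\<^sub>R v"
      have b: "b > 0" "b\<^sup>2 = g v v" using g_pos[OF False] by (auto simp: b_def)
      have w: "w = ?a *\<^sub>R y + b *\<^sub>R z" using b by (simp add: z_def v_def)
      have "g z z = 1" using b g_pos[OF False] by (simp add: z_def g_simps power2_eq_square)
      moreover have "g y v = 0" "g y (J v) = 0" "g v x = 0" "g v (J x) = 0"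
        using h us[OF h(1)] us[OF h(2)] gyy g_J_self[of y] unfolding unitary_pair_def
        by (simp_all add: v_def g_simps J_simps)
      ultimately have z: "unitary_pair g J y z" "unitary_pair g J z x"
        using h g_pos[OF False] unfolding unitary_pair_def by (simp_all add: z_def g_simps J_simps)
      have "K w x = K y x"
        using rotate[OF us[OF h(1)] z(2,1), of ?a b] b vv w by simp
      then show ?thesis using K_sym by metis
    qed
  qed
  have indep: "K x y = K x w" if h: "unitary_pair g J x y" "unitary_pair g J x w" for x y w
  proof (cases "g y (J w) = 0")
    case True
    then show ?thesis using real_indep h by blast
  next
    case False
    define r where "r = sqrt ((g y w)\<^sup>2 + (g y (J w))\<^sup>2)"
    have r: "r > 0" "r\<^sup>2 = (g y w)\<^sup>2 + (g y (J w))\<^sup>2"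
      using False by (auto simp: r_def sum_power2_gt_zero_iff)
    \<comment> \<open>The phase that makes the Hermitian product of \<open>y\<close> with
      \<open>c *\<^sub>R w + s *\<^sub>R J w\<close> real, which reduces the claim to
      \<open>real_indep\<close>.\<close>
    define c where "c = g y w / r"
    define s where "s = g y (J w) / r"
    have cs: "c\<^sup>2 + s\<^sup>2 = 1"
      unfolding c_def s_def power_divide add_divide_distrib[symmetric] r(2)[symmetric] using r(1) by simp
    have "g y (J (c *\<^sub>R w + s *\<^sub>R J w)) = 0"
      by (simp add: g_simps J_simps c_def s_def)
    then show ?thesis using real_indep[OF h(1) phase(1)[OF h(2) cs]] phase(2)[OF h(2) cs] by simp
  qed
  have "K x y = K u v" if h: "unitary_pair g J x y" "unitary_pair g J u v" for x y u v
  proof -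
    obtain z where z: "unitary_pair g J x z" "unitary_pair g J u z"
      using orth[of x u] h unfolding unitary_pair_def by blast
    have "K x y = K z x" using indep[OF h(1) z(1)] K_sym by simp
    also have "\<dots> = K z u" by (rule indep[OF us us]) (use z in auto)
    also have "\<dots> = K u v" using indep[OF h(2) z(2)] K_sym by simp
    finally show ?thesis .
  qed
  then show ?thesis unfolding K_def by metis
qed

section \<open>From one-sided bounds to equality on triples\<close>

lemma curvature_eq_if_mixed_zero:
  assumes mixed: "\<And>x y z. unitary_pair g J x y \<Longrightarrow> unitary_pair g J y z \<Longrightarrow> unitary_pair g J x z \<Longrightarrow>
      R x y y z + R z y y x = 0"
    and xy: "unitary_pair g J x y" and yz: "unitary_pair g J y z" and xz: "unitary_pair g J x z"
  shows "R x y y x = R z y y z"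
proof -
  \<comment> \<open>A quadratic form whose off-diagonal entry is zero in every orthonormal basis is
    scalar. Turned by 45 degrees, the off-diagonal entry of \<open>R u y y v\<close> becomes a
    multiple of the difference of the diagonal ones.\<close>
  define t where "t = 1 / sqrt (2 :: real)"
  have t: "t * t = 1 / 2" "t\<^sup>2 + t\<^sup>2 = 1" "(- t)\<^sup>2 + t\<^sup>2 = 1"
    by (simp_all add: t_def power2_eq_square)
  let ?x = "t *\<^sub>R x + t *\<^sub>R z" and ?z = "(- t) *\<^sub>R x + t *\<^sub>R z"
  note zy = unitary_pair_sym[OF yz]
  have "R ?x y y ?z + R ?z y y ?x = 0"
    using unitary_pair_combine[OF xy zy xz t(2)] unitary_pair_combine(1)[OF xy zy xz t(3)]
      unitary_pair_sym mixed by blast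
  moreover have "R ?x y y ?z + R ?z y y ?x = 2 * (t * t) * (R z y y z - R x y y x)"
    by (simp add: R_simps linear_diff[OF R_linear1] linear_diff[OF R_linear4] algebra_simps)
  ultimately show ?thesis unfolding t(1) by simp
qed

text \<open>\<open>J\<close> extends complex linearly, so perpendicularity reduces to the real
  products among \<open>x\<close>, \<open>y\<close>, \<open>z\<close>. In the curvature the square
  of \<open>i\<close> gives the minus sign, and the two cross terms give the imaginary part.\<close>

lemma exists_cplane_hyperbolic_rotation:
  assumes xy: "unitary_pair g J x y" and yz: "unitary_pair g J y z" and xz: "unitary_pair g J x z"
    and ab: "a\<^sup>2 - b\<^sup>2 = 1"
  obtains \<alpha> where "nondeg_antiholomorphic_cplane g J \<alpha>"
    "complex_sectional_curvature g R \<alpha> =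
      Complex (a\<^sup>2 * R x y y x - b\<^sup>2 * R z y y z) (a * b * (R x y y z + R z y y x))"
proof -
  define X where "X = complex_of_real a *s complexify_vec x + (\<i> * complex_of_real b) *s complexify_vec z"
  define Y where "Y = complexify_vec y"
  note yx = unitary_pair_sym[OF xy] and zy = unitary_pair_sym[OF yz] and zx = unitary_pair_sym[OF xz]
  note up = xy yz xz yx zy zx
  note G_real = complexify_form_real[OF g_bilinear]
  have ab': "complex_of_real a * complex_of_real a - complex_of_real b * complex_of_real b = 1"
    using ab by (metis of_real_1 of_real_diff of_real_mult power2_eq_square)
  have G: "complexify_form g X X = 1" "complexify_form g Y Y = 1" "complexify_form g X Y = 0"
    using up ab' unfolding unitary_pair_def X_def Y_def
    by (simp_all add: complexify_form_linear G_real algebra_simps)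
  have GJ: "complexify_form g V (complexify_endo J W) = 0" if "V \<in> {X, Y}" "W \<in> {X, Y}" for V W
    using that up unfolding unitary_pair_def X_def Y_def
    by (auto simp: complexify_form_linear complexify_endo_linear complexify_endo_real[OF J_linear]
      G_real g_J_self)
  note R_real = complexify_tensor4_real[OF R_linear1 R_linear2 R_linear3 R_linear4]
  have "complex_sectional_curvature g R (vec.span {X, Y}) = complexify_tensor4 R X Y Y X"
    by (rule complex_sectional_curvature_orthonormal[OF g_sym G R_skew12 R_skew34])
  also have "\<dots> = Complex (a\<^sup>2 * R x y y x - b\<^sup>2 * R z y y z) (a * b * (R x y y z + R z y y x))"
    unfolding X_def Y_def
    by (simp add: complexify_tensor4_linear R_real complex_eq_iff power2_eq_square algebra_simps)
  finally show ?thesis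
    using that nondeg_antiholomorphic_orthonormal[of g X Y J, OF g_sym G GJ] by blast
qed

lemma curvature_eq_if_one_sided_bound:
  assumes bound: "(\<forall>\<alpha>. nondeg_antiholomorphic_cplane g J \<alpha> \<longrightarrow> Re (complex_sectional_curvature g R \<alpha>) \<le> c) \<or>
      (\<forall>\<alpha>. nondeg_antiholomorphic_cplane g J \<alpha> \<longrightarrow> Re (complex_sectional_curvature g R \<alpha>) \<ge> c) \<or>
      (\<forall>\<alpha>. nondeg_antiholomorphic_cplane g J \<alpha> \<longrightarrow> Im (complex_sectional_curvature g R \<alpha>) \<le> c) \<or>
      (\<forall>\<alpha>. nondeg_antiholomorphic_cplane g J \<alpha> \<longrightarrow> Im (complex_sectional_curvature g R \<alpha>) \<ge> c)"
    and triple: "unitary_pair g J x y" "unitary_pair g J y z" "unitary_pair g J x z"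
  shows "R x y y x = R z y y z"
proof -
  note us = unitary_pair_sym
  have plane: "\<exists>\<alpha>. nondeg_antiholomorphic_cplane g J \<alpha> \<and>
      Re (complex_sectional_curvature g R \<alpha>) = R x y y x + s\<^sup>2 * (R x y y x - R z y y z) \<and>
      Im (complex_sectional_curvature g R \<alpha>) = s * sqrt (1 + s\<^sup>2) * (R x y y z + R z y y x)"
    if "unitary_pair g J x y" "unitary_pair g J y z" "unitary_pair g J x z" for x y z s
  proof -
    \<comment> \<open>One branch of the hyperbola, with \<open>b = s\<close> as parameter: the real
      part becomes affine in \<open>s\<^sup>2\<close>, the imaginary part odd in
      \<open>s\<close>.\<close>
    have "(sqrt (1 + s\<^sup>2))\<^sup>2 - s\<^sup>2 = 1" by (simp add: add_nonneg_nonneg)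
    from exists_cplane_hyperbolic_rotation[OF that this] obtain \<alpha> where "nondeg_antiholomorphic_cplane g J \<alpha>"
      "complex_sectional_curvature g R \<alpha> =
        Complex ((sqrt (1 + s\<^sup>2))\<^sup>2 * R x y y x - s\<^sup>2 * R z y y z) (sqrt (1 + s\<^sup>2) * s * (R x y y z + R z y y x))" .
    then show ?thesis by (intro exI[of _ \<alpha>]) (simp add: add_nonneg_nonneg algebra_simps)
  qed
  consider (Re_le) "\<And>\<alpha>. nondeg_antiholomorphic_cplane g J \<alpha> \<Longrightarrow> Re (complex_sectional_curvature g R \<alpha>) \<le> c"
    | (Re_ge) "\<And>\<alpha>. nondeg_antiholomorphic_cplane g J \<alpha> \<Longrightarrow> Re (complex_sectional_curvature g R \<alpha>) \<ge> c"
    | (Im_le) "\<And>\<alpha>. nondeg_antiholomorphic_cplane g J \<alpha> \<Longrightarrow> Im (complex_sectional_curvature g R \<alpha>) \<le> c"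
    | (Im_ge) "\<And>\<alpha>. nondeg_antiholomorphic_cplane g J \<alpha> \<Longrightarrow> Im (complex_sectional_curvature g R \<alpha>) \<ge> c"
    using bound by blast
  then show ?thesis
  proof cases
    case Re_le
    have "R x y y x - R z y y z \<le> 0"
      if "unitary_pair g J x y" "unitary_pair g J y z" "unitary_pair g J x z" for x y z
    proof (rule quadratic_bounded_above)
      show "R x y y x + s\<^sup>2 * (R x y y x - R z y y z) \<le> c" for s
        using plane[OF that, of s] Re_le by metis
    qed
    \<comment> \<open>Exchanging the outer vectors of the triple gives the opposite
      inequality.\<close>
    from this[OF triple] this[of z y x] show ?thesis using triple us by fastforce
  next
    case Re_ge
    have "R z y y z - R x y y x \<le> 0"
      if "unitary_pair g J x y" "unitary_pair g J y z" "unitary_pair g J x z" for x y z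
    proof (rule quadratic_bounded_above)
      fix s
      have "c \<le> R x y y x + s\<^sup>2 * (R x y y x - R z y y z)"
        using plane[OF that, of s] Re_ge by metis
      then show "- R x y y x + s\<^sup>2 * (R z y y z - R x y y x) \<le> - c"
        by (simp add: algebra_simps)
    qed
    from this[OF triple] this[of z y x] show ?thesis using triple us by fastforce
  next
    case Im_le
    show ?thesis
    proof (rule curvature_eq_if_mixed_zero[OF _ triple])
      show "R x y y z + R z y y x = 0"
        if "unitary_pair g J x y" "unitary_pair g J y z" "unitary_pair g J x z" for x y z
      proof (rule odd_bounded_above)
        show "s * sqrt (1 + s\<^sup>2) * (R x y y z + R z y y x) \<le> c" for s
          using plane[OF that, of s] Im_le by metis
      qed
    qed
  next
    case Im_ge
    show ?thesis
    proof (rule curvature_eq_if_mixed_zero[OF _ triple])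
      show "R x y y z + R z y y x = 0"
        if "unitary_pair g J x y" "unitary_pair g J y z" "unitary_pair g J x z" for x y z
      proof -
        have "- (R x y y z + R z y y x) = 0"
        proof (rule odd_bounded_above)
          show "s * sqrt (1 + s\<^sup>2) * - (R x y y z + R z y y x) \<le> - c" for s
            using plane[OF that, of s] Im_ge by (metis minus_mult_right neg_le_iff_le)
        qed
        then show ?thesis by simp
      qed
    qed
  qed
qed

lemma antiholomorphic_curvature_constant:
  assumes "CARD('n) > 4"
    and "\<exists>c. (\<forall>\<alpha>. nondeg_antiholomorphic_cplane g J \<alpha> \<longrightarrow> Re (complex_sectional_curvature g R \<alpha>) \<le> c) \<or>
      (\<forall>\<alpha>. nondeg_antiholomorphic_cplane g J \<alpha> \<longrightarrow> Re (complex_sectional_curvature g R \<alpha>) \<ge> c) \<or>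
      (\<forall>\<alpha>. nondeg_antiholomorphic_cplane g J \<alpha> \<longrightarrow> Im (complex_sectional_curvature g R \<alpha>) \<le> c) \<or>
      (\<forall>\<alpha>. nondeg_antiholomorphic_cplane g J \<alpha> \<longrightarrow> Im (complex_sectional_curvature g R \<alpha>) \<ge> c)"
  shows "\<exists>k. \<forall>\<alpha>. antiholomorphic_plane g J \<alpha> \<longrightarrow> sectional_curvature g R \<alpha> = k"
proof -
  obtain k where k: "\<And>x y. unitary_pair g J x y \<Longrightarrow> R x y y x = k"
    using curvature_constant[OF assms(1)] curvature_eq_if_one_sided_bound assms(2) by metis
  have "sectional_curvature g R \<alpha> = k" if "antiholomorphic_plane g J \<alpha>" for \<alpha>
  proof (rule sectional_curvature_orthonormal)
    show "subspace \<alpha>" "dim \<alpha> = 2" using that unfolding antiholomorphic_plane_def by auto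
    show "R x y y x = k" if "x \<in> \<alpha>" "y \<in> \<alpha>" "g x x = 1" "g y y = 1" "g x y = 0" for x y
      \<comment> \<open>Since \<open>J y\<close> lies in the image of the plane, every orthonormal
        basis of an antiholomorphic plane is a unitary pair.\<close>
      using that \<open>antiholomorphic_plane g J \<alpha>\<close> k
      unfolding antiholomorphic_plane_def unitary_pair_def by blast
  qed
  then show ?thesis by blast
qed

end
end

theorem theorem7:
  fixes A :: "('a::{t2_space, second_countable_topology}, 'n::finite) chart set"
    and g :: "'a \<Rightarrow> real ^ 'n \<Rightarrow> real ^ 'n \<Rightarrow> real"
    and J :: "'a \<Rightarrow> real ^ 'n \<Rightarrow> real ^ 'n"
    and N :: "('a \<Rightarrow> real ^ 'n) \<Rightarrow> ('a \<Rightarrow> real ^ 'n) \<Rightarrow> 'a \<Rightarrow> real ^ 'n"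
    and m :: nat
  defines "KC \<equiv> \<lambda>p. complex_sectional_curvature (g p) (curvature_tensor A g N p)"
  assumes "almost_hermitian_manifold A g J"
    and "levi_civita A g N"
    and "CARD('n) = 2 * m" and "m > 2"
    and "\<And>p. \<exists>c::real.
           (\<forall>\<alpha>. nondeg_antiholomorphic_cplane (g p) (J p) \<alpha> \<longrightarrow> Re (KC p \<alpha>) \<le> c) \<or>
           (\<forall>\<alpha>. nondeg_antiholomorphic_cplane (g p) (J p) \<alpha> \<longrightarrow> Re (KC p \<alpha>) \<ge> c) \<or>
           (\<forall>\<alpha>. nondeg_antiholomorphic_cplane (g p) (J p) \<alpha> \<longrightarrow> Im (KC p \<alpha>) \<le> c) \<or>
           (\<forall>\<alpha>. nondeg_antiholomorphic_cplane (g p) (J p) \<alpha> \<longrightarrow> Im (KC p \<alpha>) \<ge> c)"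
  shows "pointwise_constant_antiholomorphic_curvature A g J N"
  unfolding pointwise_constant_antiholomorphic_curvature_def
proof
  fix p
  have herm: "smooth_atlas A" "riemannian_metric A g" "almost_complex_structure A J"
    "\<And>v w. g p (J p v) (J p w) = g p v w"
    using assms(2) unfolding almost_hermitian_manifold_def by blast+
  have conn: "affine_connection A N" using assms(3) unfolding levi_civita_def by blast
  note ctx = herm(1) conn assms(3) herm(2)
  show "\<exists>k. \<forall>\<alpha>. antiholomorphic_plane (g p) (J p) \<alpha> \<longrightarrow>
      sectional_curvature (g p) (curvature_tensor A g N p) \<alpha> = k"
  proof (rule antiholomorphic_curvature_constant)
    show "bilinear (g p)" "g p v w = g p w v" for v w
      using herm(2) unfolding riemannian_metric_def by blast+
    show "g p v v > 0" if "v \<noteq> 0" for v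
      using herm(2) that unfolding riemannian_metric_def by blast
    show "linear (J p)" "J p (J p v) = - v" for v
      using herm(3) unfolding almost_complex_structure_def by blast+
    show "g p (J p v) (J p w) = g p v w" for v w by (rule herm(4))
    show "CARD('n) > 4" using assms(4,5) by simp
  qed (fact curvature_tensor_linear1[OF ctx] curvature_tensor_linear3[OF ctx]
      curvature_tensor_skew12[OF ctx] curvature_tensor_skew34[OF ctx] assms(6)[unfolded KC_def])+
qed

end
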